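(* The Maximum Induced Matching problem is solvable in polynomial time for $\alpha$-acyclic hypergraphs.
   Context: A hypergraph $H=(V,\mathcal{E})$ has a finite vertex set $V$ and a (multi)set $\mathcal{E}$ of subsets of $V$. Its line graph $L(H)$ has vertex set $\mathcal{E}$, two hyperedges adjacent iff they intersect; for a graph $G$, $G^2$ has the same vertices with two vertices adjacent iff their distance in $G$ is 1 or 2. A set $M\subseteq\mathcal{E}$ is an induced matching of $H$ if it is an independent set in $L(H)^2$; the Maximum Induced Matching problem asks for an induced matching of maximum cardinality. A join tree of $H$ is a tree $T$ with node set $\mathcal{E}$ such that for every $v\in V$ the hyperedges containing $v$ induce a subtree of $T$; $H$ is $\alpha$-acyclic if it has a join tree. *)

theory Defs
  imports Main "HOL-Library.Extended_Nat" "HOL-Computational_Algebra.Polynomial"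
begin

section \<open>Graphs\<close>

record 'a ugraph =
  nodes :: "'a set"
  adj :: "('a \<times> 'a) set"

definition simple_graph :: "'a ugraph \<Rightarrow> bool" where
  "simple_graph G \<longleftrightarrow> finite (nodes G) \<and> adj G \<subseteq> nodes G \<times> nodes G \<and> sym (adj G) \<and> irrefl (adj G)"

text \<open>The distance is the least length of a walk, and infinite if there is none.\<close>

definition gdist :: "'a ugraph \<Rightarrow> 'a \<Rightarrow> 'a \<Rightarrow> enat" where
  "gdist G u v = (INF n \<in> {n. (u, v) \<in> adj G ^^ n}. enat n)"

definition graph_square :: "'a ugraph \<Rightarrow> 'a ugraph" where
  "graph_square G =
     \<lparr>nodes = nodes G,
      adj = {(u, v). u \<in> nodes G \<and> v \<in> nodes G \<and> (gdist G u v = 1 \<or> gdist G u v = 2)}\<rparr>"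

definition independent_set :: "'a ugraph \<Rightarrow> 'a set \<Rightarrow> bool" where
  "independent_set G M \<longleftrightarrow> M \<subseteq> nodes G \<and> (\<forall>u\<in>M. \<forall>v\<in>M. (u, v) \<notin> adj G)"

definition induced_subgraph :: "'a ugraph \<Rightarrow> 'a set \<Rightarrow> 'a ugraph" where
  "induced_subgraph G S = \<lparr>nodes = nodes G \<inter> S, adj = adj G \<inter> S \<times> S\<rparr>"

definition connected_graph :: "'a ugraph \<Rightarrow> bool" where
  "connected_graph G \<longleftrightarrow> (\<forall>u\<in>nodes G. \<forall>v\<in>nodes G. (u, v) \<in> (adj G)\<^sup>*)"

definition graph_cycle :: "'a ugraph \<Rightarrow> 'a list \<Rightarrow> bool" where
  "graph_cycle G p \<longleftrightarrow>
     length p \<ge> 3 \<and> distinct p \<and>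
     (\<forall>i < length p. (p ! i, p ! (Suc i mod length p)) \<in> adj G)"

text \<open>
  The graph without nodes counts as a tree, so that hypergraphs without hyperedges and
  hypergraphs with isolated vertices are not excluded from having a join tree.
\<close>

definition tree_graph :: "'a ugraph \<Rightarrow> bool" where
  "tree_graph G \<longleftrightarrow> simple_graph G \<and> connected_graph G \<and> (\<nexists>p. graph_cycle G p)"


section \<open>Hypergraphs\<close>

text \<open>
  The multiset of hyperedges is an indexed family: \<open>hedges\<close> is the set of indices and \<open>ends e\<close>
  is the vertex set of hyperedge \<open>e\<close>, so distinct hyperedges may have the same vertex set.
\<close>

record ('e, 'v) hypergraph =
  verts :: "'v set"
  hedges :: "'e set"
  ends :: "'e \<Rightarrow> 'v set"

definition wf_hypergraph :: "('e, 'v) hypergraph \<Rightarrow> bool" where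
  "wf_hypergraph H \<longleftrightarrow>
     finite (verts H) \<and> finite (hedges H) \<and> (\<forall>e\<in>hedges H. ends H e \<subseteq> verts H)"

definition line_graph :: "('e, 'v) hypergraph \<Rightarrow> 'e ugraph" where
  "line_graph H =
     \<lparr>nodes = hedges H,
      adj = {(e, f). e \<in> hedges H \<and> f \<in> hedges H \<and> e \<noteq> f \<and> ends H e \<inter> ends H f \<noteq> {}}\<rparr>"

definition induced_matching :: "('e, 'v) hypergraph \<Rightarrow> 'e set \<Rightarrow> bool" where
  "induced_matching H M \<longleftrightarrow> independent_set (graph_square (line_graph H)) M"

definition maximum_induced_matching :: "('e, 'v) hypergraph \<Rightarrow> 'e set \<Rightarrow> bool" where
  "maximum_induced_matching H M \<longleftrightarrow>
     induced_matching H M \<and> (\<forall>M'. induced_matching H M' \<longrightarrow> card M' \<le> card M)"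

definition join_tree :: "('e, 'v) hypergraph \<Rightarrow> 'e ugraph \<Rightarrow> bool" where
  "join_tree H T \<longleftrightarrow>
     tree_graph T \<and> nodes T = hedges H \<and>
     (\<forall>v\<in>verts H. tree_graph (induced_subgraph T {e \<in> hedges H. v \<in> ends H e}))"

definition alpha_acyclic :: "('e, 'v) hypergraph \<Rightarrow> bool" where
  "alpha_acyclic H \<longleftrightarrow> wf_hypergraph H \<and> (\<exists>T. join_tree H T)"


section \<open>Polynomial time\<close>

text \<open>
  The model of computation is the language WHILE of N. D. Jones (Computability and Complexity
  from a Programming Perspective, MIT Press 1997): imperative programs over binary trees, where
  \<open>Leaf\<close> plays the role of nil and is also the truth value false. Its elementary operations have
  unit cost, as trees can share subtrees. The problems decidable in polynomial time in this model
  are those decidable in polynomial time by Turing machines; the same holds for search problems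
  all of whose solutions are encoded by trees of size polynomial in the size of the input.
\<close>

datatype val = Leaf | Node val val

fun left :: "val \<Rightarrow> val" where
  "left Leaf = Leaf"
| "left (Node a b) = a"

fun right :: "val \<Rightarrow> val" where
  "right Leaf = Leaf"
| "right (Node a b) = b"

type_synonym vname = nat
type_synonym state = "vname \<Rightarrow> val"

datatype exp = Var vname | NilE | ConsE exp exp | Hd exp | Tl exp

datatype cmd =
    Assign vname exp
  | Seq cmd cmd
  | Cond exp cmd cmd
  | While exp cmd

primrec eval_exp :: "exp \<Rightarrow> state \<Rightarrow> val" where
  "eval_exp (Var x) s = s x"
| "eval_exp NilE s = Leaf"
| "eval_exp (ConsE a b) s = Node (eval_exp a s) (eval_exp b s)"
| "eval_exp (Hd a) s = left (eval_exp a s)"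
| "eval_exp (Tl a) s = right (eval_exp a s)"

primrec exp_cost :: "exp \<Rightarrow> nat" where
  "exp_cost (Var x) = 1"
| "exp_cost NilE = 1"
| "exp_cost (ConsE a b) = 1 + exp_cost a + exp_cost b"
| "exp_cost (Hd a) = 1 + exp_cost a"
| "exp_cost (Tl a) = 1 + exp_cost a"

text \<open>\<open>exec c s t s'\<close>: started in state \<open>s\<close>, the command \<open>c\<close> halts in state \<open>s'\<close> after time \<open>t\<close>.\<close>

inductive exec :: "cmd \<Rightarrow> state \<Rightarrow> nat \<Rightarrow> state \<Rightarrow> bool" where
  Assign: "exec (Assign x a) s (1 + exp_cost a) (s(x := eval_exp a s))"
| Seq: "exec c s t s' \<Longrightarrow> exec d s' u s'' \<Longrightarrow> exec (Seq c d) s (t + u) s''"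
| CondTrue: "eval_exp b s \<noteq> Leaf \<Longrightarrow> exec c s t s' \<Longrightarrow>
    exec (Cond b c d) s (1 + exp_cost b + t) s'"
| CondFalse: "eval_exp b s = Leaf \<Longrightarrow> exec d s t s' \<Longrightarrow>
    exec (Cond b c d) s (1 + exp_cost b + t) s'"
| WhileFalse: "eval_exp b s = Leaf \<Longrightarrow> exec (While b c) s (1 + exp_cost b) s"
| WhileTrue: "eval_exp b s \<noteq> Leaf \<Longrightarrow> exec c s t s' \<Longrightarrow> exec (While b c) s' u s'' \<Longrightarrow>
    exec (While b c) s (1 + exp_cost b + t + u) s''"

lemma exec_deterministic:
  "exec c s t s' \<Longrightarrow> exec c s u s'' \<Longrightarrow> t = u \<and> s' = s''"
proof (induction arbitrary: u s'' rule: exec.induct)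
  case (Assign x a s)
  from Assign.prems show ?case by cases auto
next
  case (Seq c s t s' d t' r)
  from Seq.prems obtain v s1 w where
    "exec c s v s1" "exec d s1 w s''" "u = v + w"
    by cases auto
  with Seq.IH show ?case by metis
next
  case (CondTrue b s c t s' d)
  from CondTrue.prems CondTrue.hyps obtain v where "exec c s v s''" "u = 1 + exp_cost b + v"
    by cases auto
  with CondTrue.IH show ?case by metis
next
  case (CondFalse b s d t s' c)
  from CondFalse.prems CondFalse.hyps obtain v where "exec d s v s''" "u = 1 + exp_cost b + v"
    by cases auto
  with CondFalse.IH show ?case by metis
next
  case (WhileFalse b s c)
  from WhileFalse.prems WhileFalse.hyps show ?case by cases auto
next
  case (WhileTrue b s c t s' t' r)
  from WhileTrue.prems WhileTrue.hyps(1) obtain v s1 w where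
    "exec c s v s1" "exec (While b c) s1 w s''" "u = 1 + exp_cost b + v + w"
    by cases auto
  with WhileTrue.IH show ?case by metis
qed

text \<open>Variable 0 holds the input initially and the output finally; all others start as nil.\<close>

definition runs :: "cmd \<Rightarrow> val \<Rightarrow> nat \<Rightarrow> val \<Rightarrow> bool" where
  "runs c x t y \<longleftrightarrow> (\<exists>s'. exec c ((\<lambda>_. Leaf)(0 := x)) t s' \<and> s' 0 = y)"

text \<open>
  \<open>solvable_in_polytime I enc sol\<close>: one program computes, for every instance \<open>i\<close> satisfying the
  promise \<open>I\<close>, some solution \<open>y\<close> with \<open>sol i y\<close>, in time polynomial in the number \<open>size (enc i)\<close>
  of inner nodes of the encoded instance.
\<close>

definition solvable_in_polytime :: "('i \<Rightarrow> bool) \<Rightarrow> ('i \<Rightarrow> val) \<Rightarrow> ('i \<Rightarrow> val \<Rightarrow> bool) \<Rightarrow> bool" where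
  "solvable_in_polytime I enc sol \<longleftrightarrow>
     (\<exists>c (p :: nat poly). \<forall>i. I i \<longrightarrow>
        (\<exists>t y. runs c (enc i) t y \<and> t \<le> poly p (size (enc i)) \<and> sol i y))"


section \<open>The Maximum Induced Matching problem\<close>

fun enc_list :: "val list \<Rightarrow> val" where
  "enc_list [] = Leaf"
| "enc_list (x # xs) = Node x (enc_list xs)"

definition enc_bool :: "bool \<Rightarrow> val" where
  "enc_bool b = (if b then Node Leaf Leaf else Leaf)"

definition enc_nat :: "nat \<Rightarrow> val" where
  "enc_nat n = enc_list (replicate n Leaf)"

text \<open>
  A hypergraph is given by its number of vertices, in unary, and its incidence matrix, with one row
  for each hyperedge; vertices and hyperedges are taken in the increasing order of their labels.
\<close>

definition enc_hypergraph :: "(nat, nat) hypergraph \<Rightarrow> val" where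
  "enc_hypergraph H =
     Node (enc_nat (card (verts H)))
       (enc_list (map (\<lambda>e. enc_list (map (\<lambda>v. enc_bool (v \<in> ends H e)) (sorted_list_of_set (verts H))))
          (sorted_list_of_set (hedges H))))"

text \<open>A set of hyperedges is given by its characteristic vector.\<close>

definition enc_hedge_set :: "(nat, nat) hypergraph \<Rightarrow> nat set \<Rightarrow> val" where
  "enc_hedge_set H M =
     enc_list (map (\<lambda>e. enc_bool (e \<in> M)) (sorted_list_of_set (hedges H)))"

definition solves_maximum_induced_matching :: "(nat, nat) hypergraph \<Rightarrow> val \<Rightarrow> bool" where
  "solves_maximum_induced_matching H y \<longleftrightarrow>
     (\<exists>M. maximum_induced_matching H M \<and> y = enc_hedge_set H M)"

end

theory Submission
  imports Defs
begin

text \<open>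
  Call two hyperedges in conflict if some hyperedge meets both of them; an induced matching is a
  set of hyperedges without conflict. In a join tree the hyperedges that meet a given hyperedge
  (together with it) form a subtree, and two hyperedges are in conflict iff their subtrees
  intersect. Removing leaves one by one shows that in every nonempty family of subtrees
  some member has the property that all members meeting it meet each other. Hence every
  nonempty set of hyperedges has a simplicial element with respect to conflict, and choosing it
  while discarding everything in conflict with it is optimal. This greedy algorithm does not need
  the join tree.
\<close>

section \<open>Subtrees of a forest\<close>

text \<open>Two obstacles shape the development. No elimination order is known in advance, and a
  hyperedge that is not simplicial at its turn may become so after later discards. The algorithm
  therefore sweeps over all hyperedges repeatedly and tests simpliciality by brute force among the
  undecided ones. Each sweep decides at least one while any is left, so as many sweeps as there are
  hyperedges suffice. The join tree enters only through the existence of simplicial hyperedges, that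
  is, chordality of the square of the line graph. The other obstacle is the machine model. With
  sharing, one assignment can double the size of a value, so a loop with a polynomial-time body need
  not be polynomial. Hence the algorithm is a nest of folds over the rows, and the statuses are
  chosen so that no elimination step enlarges the state.\<close>

definition connected_in :: "('a \<times> 'a) set \<Rightarrow> 'a set \<Rightarrow> bool" where
  "connected_in E X \<longleftrightarrow> (\<forall>u\<in>X. \<forall>v\<in>X. (u, v) \<in> (E \<inter> X \<times> X)\<^sup>*)"

text \<open>Take the first node of a longest path: by maximality all its neighbours lie on the path,
  and a neighbour other than the second node would close a cycle. If the node is isolated,
  \<open>p\<close> is arbitrary.\<close>

lemma acyclic_low_degree:
  assumes G: "simple_graph G" and ac: "\<nexists>p. graph_cycle G p" and ne: "nodes G \<noteq> {}"
  obtains l p where "l \<in> nodes G" and "\<And>y. (l, y) \<in> adj G \<Longrightarrow> y = p"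
proof -
  define P where "P = (\<lambda>xs. distinct xs \<and> xs \<noteq> [] \<and> set xs \<subseteq> nodes G \<and> successively (\<lambda>a b. (a, b) \<in> adj G) xs)"
  from G have fin: "finite (nodes G)" and sub: "adj G \<subseteq> nodes G \<times> nodes G"
    and sym: "sym (adj G)" and irr: "irrefl (adj G)"
    by (auto simp: simple_graph_def)
  from ne obtain a where "a \<in> nodes G" by auto
  then have "P [a]" by (simp add: P_def)
  moreover have "\<forall>xs. P xs \<longrightarrow> length xs < Suc (card (nodes G))"
    unfolding P_def by (metis card_mono distinct_card fin less_Suc_eq_le)
  ultimately obtain xs where xs: "P xs" and max: "\<And>ys. P ys \<Longrightarrow> length ys \<le> length xs"
    using ex_has_greatest_nat[of P "[a]" length] by blast
  obtain l zs where l: "xs = l # zs" using xs by (cases xs) (auto simp: P_def)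
  have on: "y \<in> set zs" if "(l, y) \<in> adj G" for y
  proof (rule ccontr)
    assume "y \<notin> set zs"
    moreover have "y \<noteq> l" using that irr by (auto simp: irrefl_def)
    moreover have "(y, l) \<in> adj G" using that sym by (auto dest: symD)
    ultimately have "P (y # xs)" using xs that sub l by (auto simp: P_def)
    from max[OF this] show False by simp
  qed
  have "y = hd zs" if ly: "(l, y) \<in> adj G" for y
  proof (rule ccontr)
    assume ny: "y \<noteq> hd zs"
    from on[OF ly] obtain i where i: "i < length zs" "zs ! i = y" by (auto simp: in_set_conv_nth)
    with ny have i0: "0 < i" by (cases i) (auto simp: hd_conv_nth)
    \<comment> \<open>\<open>y\<close> has index \<open>i\<close> in \<open>zs\<close>, hence
      \<open>Suc i\<close> in \<open>xs\<close>; the prefix ending there has at least three nodes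
      because \<open>i\<close> is positive.\<close>
    let ?c = "take (Suc (Suc i)) xs"
    have len: "length ?c = Suc (Suc i)" using i l by simp
    have "(?c ! j, ?c ! (Suc j mod length ?c)) \<in> adj G" if j: "j < length ?c" for j
    proof (cases "j = Suc i")
      case True
      then have "?c ! j = y" "?c ! (Suc j mod length ?c) = l" using i l len by auto
      then show ?thesis using ly sym by (auto dest: symD)
    next
      case False
      with j len have "Suc j < length xs" "Suc j < Suc (Suc i)" using i l by auto
      then show ?thesis using xs len by (simp add: P_def successively_conv_nth)
    qed
    then have "graph_cycle G ?c"
      unfolding graph_cycle_def using xs i0 len by (auto simp: P_def)
    with ac show False by blast
  qed
  with that[of l "hd zs"] xs l show thesis by (auto simp: P_def)
qed

lemma acyclic_remove_node:
  assumes "simple_graph G" and "\<nexists>p. graph_cycle G p"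
  shows "simple_graph (induced_subgraph G S)" and "\<nexists>p. graph_cycle (induced_subgraph G S) p"
  using assms
  by (auto simp: simple_graph_def induced_subgraph_def sym_def irrefl_def graph_cycle_def)

text \<open>A walk that enters \<open>l\<close> comes from \<open>p\<close> and can only leave to
  \<open>p\<close>, so the detour can be cut out.\<close>

lemma connected_in_remove_leaf:
  assumes X: "connected_in E X" and sym: "sym E" and leaf: "\<And>y. (l, y) \<in> E \<Longrightarrow> y = p"
  shows "connected_in E (X - {l})"
proof -
  let ?R = "E \<inter> (X - {l}) \<times> (X - {l})"
  \<comment> \<open>The induction must also cover walks that currently stand on \<open>l\<close>;
    for these it records that \<open>p\<close> is reachable without \<open>l\<close>.\<close>
  have "(w \<noteq> l \<longrightarrow> (u, w) \<in> ?R\<^sup>*) \<and> (w = l \<longrightarrow> (u, p) \<in> ?R\<^sup>*)"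
    if "(u, w) \<in> (E \<inter> X \<times> X)\<^sup>*" and u: "u \<noteq> l" for u w
    using that(1)
  proof (induction rule: rtrancl_induct)
    case base
    then show ?case using u by auto
  next
    case (step v w)
    have wv: "(w, v) \<in> E" using step(2) sym by (auto dest: symD)
    show ?case
    proof (cases "v = l")
      case True
      then have "w = p" using leaf step(2) by auto
      then show ?thesis using True step by auto
    next
      case v: False
      show ?thesis
      proof (cases "w = l")
        case True
        then have "v = p" using leaf wv by auto
        then show ?thesis using v True step by auto
      next
        case False
        then have "(v, w) \<in> ?R" using v step(2) by auto
        then show ?thesis using v False step by (auto intro: rtrancl_into_rtrancl)
      qed
    qed
  qed
  then show ?thesis using X unfolding connected_in_def by blast
qed

lemma connected_in_leaf_neighbour:
  assumes X: "connected_in E X" and l: "l \<in> X" "X \<noteq> {l}" and leaf: "\<And>y. (l, y) \<in> E \<Longrightarrow> y = p"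
  shows "p \<in> X"
proof -
  obtain v where v: "v \<in> X" "v \<noteq> l" using l by auto
  then have "(l, v) \<in> (E \<inter> X \<times> X)\<^sup>*" using X l by (auto simp: connected_in_def)
  then obtain y where "(l, y) \<in> E \<inter> X \<times> X" using v by (metis converse_rtranclE)
  then show ?thesis using leaf by auto
qed

text \<open>Induction on the number of nodes, deleting a node \<open>l\<close> of degree at most
  one. A member equal to \<open>{l}\<close> is as desired, since everything that meets it contains
  \<open>l\<close>. Otherwise every member containing \<open>l\<close> also contains its neighbour
  \<open>p\<close>, so the deletion neither empties a member nor changes which members meet.
  Indexing keeps apart members that become equal on deletion.\<close>

lemma forest_simplicial_subtree:
  assumes "simple_graph G" and "\<nexists>p. graph_cycle G p" and "R \<noteq> {}"
    and "\<And>i. i \<in> R \<Longrightarrow> X i \<noteq> {} \<and> X i \<subseteq> nodes G \<and> connected_in (adj G) (X i)"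
  shows "\<exists>i\<in>R. \<forall>j\<in>R. \<forall>k\<in>R. X i \<inter> X j \<noteq> {} \<longrightarrow> X i \<inter> X k \<noteq> {} \<longrightarrow> X j \<inter> X k \<noteq> {}"
  using assms
proof (induction "card (nodes G)" arbitrary: G X rule: less_induct)
  case less
  note G = less.prems(1,2) and X = less.prems(4)
  have sym: "sym (adj G)" and fin: "finite (nodes G)" and sub: "adj G \<subseteq> nodes G \<times> nodes G"
    using G by (auto simp: simple_graph_def)
  have ne: "nodes G \<noteq> {}" using less.prems(3) X by fastforce
  obtain l p where l: "l \<in> nodes G" and leaf: "\<And>y. (l, y) \<in> adj G \<Longrightarrow> y = p"
    using acyclic_low_degree[OF G ne] by metis
  show ?case
  proof (cases "\<exists>i\<in>R. X i = {l}")
    case True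
    then obtain i where "i \<in> R" "X i = {l}" by auto
    then show ?thesis by (intro bexI[of _ i]) auto
  next
    case False
    let ?G = "induced_subgraph G (- {l})"
    let ?X = "\<lambda>i. X i - {l}"
    have card: "card (nodes ?G) < card (nodes G)"
      using l fin by (auto simp: induced_subgraph_def intro!: psubset_card_mono)
    \<comment> \<open>\<open>leaf\<close> alone does not exclude \<open>p = l\<close> when
      \<open>l\<close> is isolated; a member with \<open>l\<close> and another node supplies an edge
      at \<open>l\<close>.\<close>
    have pX: "p \<in> X i - {l}" if i: "i \<in> R" and li: "l \<in> X i" for i
    proof -
      have Xi: "connected_in (adj G) (X i)" and Xl: "X i \<noteq> {l}" using X[OF i] False i by auto
      have p: "p \<in> X i" using connected_in_leaf_neighbour[OF Xi li Xl leaf] .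
      obtain v where v: "v \<in> X i" "v \<noteq> l" using Xl li by auto
      have "(l, v) \<in> (adj G \<inter> X i \<times> X i)\<^sup>*" using Xi li v by (simp add: connected_in_def)
      then obtain y where "(l, y) \<in> adj G" using v(2) by (metis IntD1 converse_rtranclE)
      then have "(l, p) \<in> adj G" using leaf by metis
      then have "p \<noteq> l" using G(1) by (auto simp: simple_graph_def irrefl_def)
      with p show ?thesis by simp
    qed
    have "\<exists>i\<in>R. \<forall>j\<in>R. \<forall>k\<in>R. ?X i \<inter> ?X j \<noteq> {} \<longrightarrow> ?X i \<inter> ?X k \<noteq> {} \<longrightarrow> ?X j \<inter> ?X k \<noteq> {}"
    proof (rule less.hyps[OF card acyclic_remove_node(1)[OF G] acyclic_remove_node(2)[OF G] less.prems(3)])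
      fix i assume i: "i \<in> R"
      \<comment> \<open>Connectedness of \<open>?X i\<close> involves only edges inside it, so
        passing to \<open>?G\<close> does not affect it.\<close>
      have "adj ?G \<inter> ?X i \<times> ?X i = adj G \<inter> ?X i \<times> ?X i" by (auto simp: induced_subgraph_def)
      moreover have "connected_in (adj G) (?X i)"
        using connected_in_remove_leaf[OF _ sym leaf] X[OF i] by blast
      ultimately have "connected_in (adj ?G) (?X i)" by (simp add: connected_in_def)
      moreover have "?X i \<noteq> {}" using X[OF i] False i by (metis Diff_eq_empty_iff subset_singletonD)
      ultimately show "?X i \<noteq> {} \<and> ?X i \<subseteq> nodes ?G \<and> connected_in (adj ?G) (?X i)"
        using X[OF i] by (auto simp: induced_subgraph_def)
    qed
    moreover have "X i \<inter> X j \<noteq> {} \<longleftrightarrow> ?X i \<inter> ?X j \<noteq> {}" if "i \<in> R" "j \<in> R" for i j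
      using pX[OF that(1)] pX[OF that(2)] by blast
    ultimately show ?thesis by simp
  qed
qed

section \<open>Conflicting hyperedges\<close>

definition conflict :: "('e, 'v) hypergraph \<Rightarrow> 'e \<Rightarrow> 'e \<Rightarrow> bool" where
  "conflict H e f \<longleftrightarrow> (\<exists>h\<in>hedges H. ends H h \<inter> ends H e \<noteq> {} \<and> ends H h \<inter> ends H f \<noteq> {})"

lemma gdist_le: "(u, v) \<in> adj G ^^ n \<Longrightarrow> gdist G u v \<le> enat n"
  unfolding gdist_def by (rule INF_lower) simp

text \<open>A nonempty set of walk lengths attains its infimum, and the empty set would give
  distance infinity.\<close>

lemma gdist_eq_enatD:
  assumes "gdist G u v = enat n"
  shows "(u, v) \<in> adj G ^^ n"
proof -
  let ?A = "{n. (u, v) \<in> adj G ^^ n}"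
  have "?A \<noteq> {}"
  proof
    assume "?A = {}"
    then show False using assms unfolding gdist_def by (simp only:) (simp add: top_enat_def)
  qed
  then have "Inf (enat ` ?A) \<in> enat ` ?A" by (auto intro: wellorder_InfI)
  moreover have "Inf (enat ` ?A) = enat n" using assms by (simp add: gdist_def)
  ultimately have "enat n \<in> enat ` ?A" by metis
  then show ?thesis by auto
qed

text \<open>The hyperedge \<open>h\<close> of a conflict is the midpoint of a walk of length two,
  unless it is \<open>e\<close> or \<open>f\<close>, and then these two intersect. The diagonal is
  excluded separately: a nonempty hyperedge conflicts with itself, but its distance to itself is
  0.\<close>

lemma conflict_iff_square:
  assumes e: "e \<in> hedges H" and f: "f \<in> hedges H"
  shows "(e, f) \<in> adj (graph_square (line_graph H)) \<longleftrightarrow> e \<noteq> f \<and> conflict H e f"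
proof
  let ?L = "line_graph H"
  assume "(e, f) \<in> adj (graph_square ?L)"
  then have d: "gdist ?L e f = enat 1 \<or> gdist ?L e f = enat 2"
    by (auto simp: graph_square_def one_enat_def numeral_eq_enat)
  have "e \<noteq> f"
  proof
    assume "e = f"
    then have "gdist ?L e f \<le> enat 0" by (intro gdist_le) simp
    with d show False by auto
  qed
  moreover have "conflict H e f"
    using d
  proof
    assume "gdist ?L e f = enat 1"
    then have "(e, f) \<in> adj ?L" by (auto dest: gdist_eq_enatD)
    then show ?thesis by (auto simp: line_graph_def conflict_def)
  next
    assume "gdist ?L e f = enat 2"
    then have "(e, f) \<in> adj ?L O adj ?L"
      by (auto dest!: gdist_eq_enatD simp: numeral_2_eq_2)
    then show ?thesis by (fastforce simp: line_graph_def conflict_def)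
  qed
  ultimately show "e \<noteq> f \<and> conflict H e f" ..
next
  let ?L = "line_graph H"
  assume ef: "e \<noteq> f \<and> conflict H e f"
  then obtain h where h: "h \<in> hedges H" "ends H h \<inter> ends H e \<noteq> {}" "ends H h \<inter> ends H f \<noteq> {}"
    by (auto simp: conflict_def)
  have "gdist ?L e f \<le> enat 2"
  proof (cases "h = e \<or> h = f")
    case True
    then have "(e, f) \<in> adj ?L ^^ 1" using h e f ef by (auto simp: line_graph_def)
    from gdist_le[OF this] show ?thesis by (rule order_trans) simp
  next
    case False
    then have "(e, h) \<in> adj ?L" "(h, f) \<in> adj ?L" using h e f by (auto simp: line_graph_def)
    then have "(e, f) \<in> adj ?L ^^ 2" by (auto simp: numeral_2_eq_2)
    then show ?thesis by (rule gdist_le)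
  qed
  then obtain n where n: "gdist ?L e f = enat n" "n \<le> 2" by (cases "gdist ?L e f") auto
  then have "n \<noteq> 0" using ef by (cases n) (auto dest!: gdist_eq_enatD)
  with n have "gdist ?L e f = 1 \<or> gdist ?L e f = 2"
    by (auto simp: one_enat_def numeral_eq_enat numeral_2_eq_2 le_Suc_eq)
  then show "(e, f) \<in> adj (graph_square ?L)"
    using e f by (simp add: graph_square_def line_graph_def)
qed

lemma induced_matching_iff:
  "induced_matching H M \<longleftrightarrow> M \<subseteq> hedges H \<and> (\<forall>e\<in>M. \<forall>f\<in>M. e \<noteq> f \<longrightarrow> \<not> conflict H e f)"
proof -
  have "nodes (graph_square (line_graph H)) = hedges H"
    by (simp add: graph_square_def line_graph_def)
  moreover have "(\<forall>e\<in>M. \<forall>f\<in>M. (e, f) \<notin> adj (graph_square (line_graph H))) \<longleftrightarrow>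
      (\<forall>e\<in>M. \<forall>f\<in>M. e \<noteq> f \<longrightarrow> \<not> conflict H e f)" if "M \<subseteq> hedges H"
    using that by (intro ball_cong refl) (auto simp: conflict_iff_square subset_iff)
  ultimately show ?thesis
    unfolding induced_matching_def independent_set_def by blast
qed

text \<open>The set \<open>X e\<close> in the proof is the union of \<open>{e}\<close> and the
  subtrees belonging to the vertices of \<open>e\<close>; all of these contain \<open>e\<close>, so
  the union is connected.\<close>

lemma alpha_acyclic_simplicial:
  assumes "alpha_acyclic H" and R: "R \<subseteq> hedges H" "R \<noteq> {}"
  shows "\<exists>e\<in>R. \<forall>f\<in>R. \<forall>g\<in>R. conflict H e f \<longrightarrow> conflict H e g \<longrightarrow> conflict H f g"
proof -
  obtain T where wf: "wf_hypergraph H" and T: "join_tree H T"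
    using assms by (auto simp: alpha_acyclic_def)
  \<comment> \<open>The disjunct \<open>g = e\<close> keeps \<open>X e\<close> nonempty when
    \<open>e\<close> has no vertices.\<close>
  define X where "X = (\<lambda>e. {g \<in> hedges H. g = e \<or> ends H g \<inter> ends H e \<noteq> {}})"
  have G: "simple_graph T" "\<nexists>p. graph_cycle T p" and nT: "nodes T = hedges H"
    using T by (auto simp: join_tree_def tree_graph_def)
  have path: "(u, e) \<in> (adj T \<inter> X e \<times> X e)\<^sup>* \<and> (e, u) \<in> (adj T \<inter> X e \<times> X e)\<^sup>*"
    if e: "e \<in> hedges H" and u: "u \<in> X e" for e u
  proof (cases "u = e")
    case False
    then obtain v where v: "v \<in> ends H u" "v \<in> ends H e" and uH: "u \<in> hedges H"
      using u by (auto simp: X_def)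
    then have "v \<in> verts H" using wf e by (auto simp: wf_hypergraph_def)
    let ?S = "{e \<in> hedges H. v \<in> ends H e}"
    have "connected_graph (induced_subgraph T ?S)"
      using T \<open>v \<in> verts H\<close> by (auto simp: join_tree_def tree_graph_def)
    then have "(u, e) \<in> (adj T \<inter> ?S \<times> ?S)\<^sup>*" "(e, u) \<in> (adj T \<inter> ?S \<times> ?S)\<^sup>*"
      using v e uH nT by (auto simp: connected_graph_def induced_subgraph_def)
    moreover have "adj T \<inter> ?S \<times> ?S \<subseteq> adj T \<inter> X e \<times> X e"
      using v by (auto simp: X_def)
    ultimately show ?thesis by (meson rtrancl_mono subsetD)
  qed auto
  have "\<exists>e\<in>R. \<forall>f\<in>R. \<forall>g\<in>R. X e \<inter> X f \<noteq> {} \<longrightarrow> X e \<inter> X g \<noteq> {} \<longrightarrow> X f \<inter> X g \<noteq> {}"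
  proof (rule forest_simplicial_subtree[OF G R(2)])
    fix e assume "e \<in> R"
    then have e: "e \<in> hedges H" using R by auto
    then have "connected_in (adj T) (X e)"
      unfolding connected_in_def using path by (meson rtrancl_trans)
    moreover have "e \<in> X e" using e by (simp add: X_def)
    ultimately show "X e \<noteq> {} \<and> X e \<subseteq> nodes T \<and> connected_in (adj T) (X e)"
      using nT by (auto simp: X_def)
  qed
  then obtain e where e: "e \<in> R"
    and es: "\<And>f g. f \<in> R \<Longrightarrow> g \<in> R \<Longrightarrow> X e \<inter> X f \<noteq> {} \<Longrightarrow> X e \<inter> X g \<noteq> {} \<Longrightarrow> X f \<inter> X g \<noteq> {}"
    by blast
  have meet: "conflict H f g \<Longrightarrow> X f \<inter> X g \<noteq> {}" for f g
    by (auto simp: X_def conflict_def)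
  \<comment> \<open>A hyperedge without vertices has a nonempty subtree but is in conflict with
    nothing, not even itself; hence the two nonemptiness conditions.\<close>
  have eq: "conflict H f g" if "X f \<inter> X g \<noteq> {}" "ends H f \<noteq> {}" "ends H g \<noteq> {}" for f g
    using that by (auto simp: X_def conflict_def)
  have "conflict H f g" if "f \<in> R" "g \<in> R" "conflict H e f" "conflict H e g" for f g
  proof (rule eq)
    show "X f \<inter> X g \<noteq> {}" using es that meet by blast
    show "ends H f \<noteq> {}" "ends H g \<noteq> {}" using that by (auto simp: conflict_def)
  qed
  with e show ?thesis by blast
qed

section \<open>The greedy algorithm\<close>

text \<open>The third assumption makes the graph of \<open>C\<close> chordal: every nonempty induced
  subgraph has a simplicial vertex. \<open>C\<close> need not be reflexive, as a hyperedge without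
  vertices is not in conflict with itself; hence the tests \<open>x \<noteq> e\<close>
  below.\<close>

locale simplicial_elimination =
  fixes V :: "'a set" and C :: "'a \<Rightarrow> 'a \<Rightarrow> bool"
  assumes finite_V: "finite V"
    and C_sym: "C x y \<longleftrightarrow> C y x"
    and ex_simplicial: "R \<subseteq> V \<Longrightarrow> R \<noteq> {} \<Longrightarrow> \<exists>e\<in>R. \<forall>f\<in>R. \<forall>g\<in>R. C e f \<longrightarrow> C e g \<longrightarrow> C f g"
begin

definition independent :: "'a set \<Rightarrow> bool" where
  "independent I \<longleftrightarrow> I \<subseteq> V \<and> (\<forall>x\<in>I. \<forall>y\<in>I. x \<noteq> y \<longrightarrow> \<not> C x y)"

definition simplicial :: "'a \<Rightarrow> 'a set \<Rightarrow> bool" where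
  "simplicial e A \<longleftrightarrow> (\<forall>f\<in>A. \<forall>g\<in>A. C e f \<longrightarrow> C e g \<longrightarrow> C f g)"

definition greedy_step :: "'a \<Rightarrow> 'a set \<times> 'a set \<Rightarrow> 'a set \<times> 'a set" where
  "greedy_step e = (\<lambda>(S, A). if e \<in> A \<and> simplicial e A
     then (insert e S, {x \<in> A. x \<noteq> e \<and> \<not> C e x}) else (S, A))"

text \<open>The loop invariant, with \<open>S\<close> chosen and \<open>A\<close> undecided: some
  maximum independent set still arises from \<open>S\<close> by adding undecided elements.
  Quantifying over all \<open>I\<close> lets it hold initially with \<open>J = I\<close>, and
  \<open>A = {}\<close> forces \<open>J = S\<close>.\<close>

definition extendable :: "'a set \<times> 'a set \<Rightarrow> bool" where
  "extendable = (\<lambda>(S, A). A \<subseteq> V \<and> S \<inter> A = {} \<and> (\<forall>x\<in>S. \<forall>y\<in>A. \<not> C x y) \<and>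
     (\<forall>I. independent I \<longrightarrow> (\<exists>J. independent J \<and> S \<subseteq> J \<and> J \<subseteq> S \<union> A \<and> card I \<le> card J)))"

text \<open>If \<open>e\<close> is not in \<open>J\<close>, the members of \<open>J\<close> in
  conflict with \<open>e\<close> lie in \<open>A\<close> and would be pairwise in conflict because
  \<open>e\<close> is simplicial. So there is at most one, and it can be traded for
  \<open>e\<close>.\<close>

lemma exchange_simplicial:
  assumes AV: "A \<subseteq> V" and SA: "\<And>x y. x \<in> S \<Longrightarrow> y \<in> A \<Longrightarrow> \<not> C x y"
    and e: "e \<in> A" "simplicial e A"
    and J: "independent J" "S \<subseteq> J" "J \<subseteq> S \<union> A"
  shows "\<exists>K. independent K \<and> insert e S \<subseteq> K \<and> K \<subseteq> insert e S \<union> {x \<in> A. x \<noteq> e \<and> \<not> C e x} \<and> card J \<le> card K"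
proof (cases "e \<in> J")
  case True
  then have "x \<noteq> e \<longrightarrow> \<not> C e x" if "x \<in> J" for x using J(1) that by (auto simp: independent_def)
  then show ?thesis using J True by (intro exI[of _ J]) auto
next
  case False
  let ?N = "{x \<in> J. x \<in> A \<and> C e x}"
  let ?K = "insert e (J - ?N)"
  have finJ: "finite J" using J(1) finite_V by (auto simp: independent_def intro: finite_subset)
  have "x = y" if "x \<in> ?N" "y \<in> ?N" for x y
    using that e J(1) unfolding simplicial_def independent_def by blast
  then have "card ?N \<le> 1"
    using finJ by (intro card_le_Suc0_iff_eq[THEN iffD2, folded One_nat_def]) auto
  moreover have "card ?K = Suc (card J - card ?N)" using False finJ by (simp add: card_Diff_subset)
  ultimately have "card J \<le> card ?K" by linarith
  moreover have no: "\<not> C e x" if "x \<in> J - ?N" for x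
    using that J(3) SA[OF _ e(1)] C_sym by blast
  have "independent ?K"
    unfolding independent_def
  proof (intro conjI ballI impI)
    show "?K \<subseteq> V" using J(1) AV e(1) by (auto simp: independent_def)
    fix x y assume "x \<in> ?K" "y \<in> ?K" "x \<noteq> y"
    then show "\<not> C x y" using no J(1) C_sym unfolding independent_def by blast
  qed
  moreover have "S \<subseteq> ?K" using J(2) SA[OF _ e(1)] C_sym by blast
  moreover have "?K \<subseteq> insert e S \<union> {x \<in> A. x \<noteq> e \<and> \<not> C e x}" using J(3) False no by blast
  ultimately show ?thesis by (intro exI[of _ ?K]) auto
qed

lemma extendable_greedy_step:
  assumes "extendable \<sigma>"
  shows "extendable (greedy_step e \<sigma>)"
proof -
  obtain S A where \<sigma>: "\<sigma> = (S, A)" by (cases \<sigma>)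
  show ?thesis
  proof (cases "e \<in> A \<and> simplicial e A")
    case False
    then show ?thesis using assms by (auto simp: greedy_step_def \<sigma>)
  next
    case True
    have AV: "A \<subseteq> V" and disj: "S \<inter> A = {}" and SA: "\<And>x y. x \<in> S \<Longrightarrow> y \<in> A \<Longrightarrow> \<not> C x y"
      and ext: "\<And>I. independent I \<Longrightarrow> \<exists>J. independent J \<and> S \<subseteq> J \<and> J \<subseteq> S \<union> A \<and> card I \<le> card J"
      using assms by (auto simp: extendable_def \<sigma>)
    have "\<exists>K. independent K \<and> insert e S \<subseteq> K \<and> K \<subseteq> insert e S \<union> {x \<in> A. x \<noteq> e \<and> \<not> C e x} \<and> card I \<le> card K"
      if I: "independent I" for I
    proof -
      obtain J where J: "independent J" "S \<subseteq> J" "J \<subseteq> S \<union> A" "card I \<le> card J"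
        using ext[OF I] by blast
      then show ?thesis using exchange_simplicial[OF AV SA _ _ J(1-3)] True by (meson le_trans)
    qed
    moreover have "greedy_step e \<sigma> = (insert e S, {x \<in> A. x \<noteq> e \<and> \<not> C e x})"
      using True by (simp add: greedy_step_def \<sigma>)
    ultimately show ?thesis using AV SA disj by (simp add: extendable_def) blast
  qed
qed

lemma extendable_init: "extendable ({}, V)"
  by (auto simp: extendable_def independent_def)

lemma extendable_greedy:
  "extendable \<sigma> \<Longrightarrow> extendable ((fold greedy_step es ^^ n) \<sigma>)"
proof -
  have pass: "extendable (fold greedy_step es \<sigma>)" if "extendable \<sigma>" for \<sigma>
    using that
  proof (induction es arbitrary: \<sigma>)
    case (Cons e es)
    from Cons.IH[OF extendable_greedy_step[OF Cons.prems]] show ?case by simp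
  qed simp
  show "extendable \<sigma> \<Longrightarrow> extendable ((fold greedy_step es ^^ n) \<sigma>)"
    by (induction n) (auto intro: pass)
qed

text \<open>A pass that changes nothing has tested every \<open>e\<close> against the same
  \<open>A\<close>. By \<open>ex_simplicial\<close> this is impossible when \<open>es\<close> covers
  a nonempty \<open>A \<subseteq> V\<close>, so such a pass makes progress.\<close>

lemma greedy_pass_decreases:
  assumes "finite A"
  shows "(fold greedy_step es (S, A) = (S, A) \<and> (\<forall>e\<in>set es. \<not> (e \<in> A \<and> simplicial e A)))
    \<or> card (snd (fold greedy_step es (S, A))) < card A"
proof -
  have mono: "snd (fold greedy_step es \<sigma>) \<subseteq> snd \<sigma>" for es \<sigma>
  proof (induction es arbitrary: \<sigma>)
    case (Cons e es)
    have "snd (greedy_step e \<sigma>) \<subseteq> snd \<sigma>" by (auto simp: greedy_step_def split: prod.splits)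
    with Cons show ?case by fastforce
  qed simp
  show ?thesis
  proof (induction es)
    case (Cons e es)
    show ?case
    proof (cases "e \<in> A \<and> simplicial e A")
      case True
      then have "snd (greedy_step e (S, A)) \<subset> A" by (auto simp: greedy_step_def)
      with mono[of es "greedy_step e (S, A)"]
      have "snd (fold greedy_step (e # es) (S, A)) \<subset> A" by auto
      then show ?thesis using assms psubset_card_mono by blast
    next
      case False
      then have "greedy_step e (S, A) = (S, A)" by (auto simp: greedy_step_def)
      then show ?thesis using Cons False by auto
    qed
  qed simp
qed

lemma greedy_exhausts:
  assumes es: "set es = V"
  shows "snd ((fold greedy_step es ^^ card V) ({}, V)) = {}"
proof -
  let ?\<sigma> = "\<lambda>n. (fold greedy_step es ^^ n) ({}, V)"
  have AV: "snd (?\<sigma> n) \<subseteq> V" for n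
    using extendable_greedy[OF extendable_init, of n es] by (auto simp: extendable_def split: prod.splits)
  have "card (snd (?\<sigma> n)) \<le> card V - n" for n
  proof (induction n)
    case (Suc n)
    obtain S A where SA: "?\<sigma> n = (S, A)" by (cases "?\<sigma> n")
    have A: "A \<subseteq> V" "finite A" using AV[of n] finite_V SA by (auto intro: finite_subset)
    show ?case
    proof (cases "A = {}")
      case True
      then have "fold greedy_step es (S, A) = (S, A)" using greedy_pass_decreases[OF A(2), of es S] by auto
      then show ?thesis using SA True by simp
    next
      case False
      from ex_simplicial[OF A(1) False] obtain e where "e \<in> A" "simplicial e A"
        by (auto simp: simplicial_def)
      then have "card (snd (fold greedy_step es (S, A))) < card A"
        using greedy_pass_decreases[OF A(2), of es S] A(1) es by blast
      then show ?thesis using Suc SA by simp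
    qed
  qed simp
  from this[of "card V"] AV[of "card V"] finite_V show ?thesis
    by (metis card_0_eq diff_self_eq_0 finite_subset le_zero_eq)
qed

lemma greedy_maximum:
  assumes "set es = V"
  obtains S where "(fold greedy_step es ^^ card V) ({}, V) = (S, {})"
    and "independent S" and "\<And>I. independent I \<Longrightarrow> card I \<le> card S"
proof -
  let ?\<sigma> = "(fold greedy_step es ^^ card V) ({}, V)"
  obtain S where S: "?\<sigma> = (S, {})" using greedy_exhausts[OF assms] by (cases ?\<sigma>) auto
  have "extendable (S, {})" using extendable_greedy[OF extendable_init, of "card V" es] S by simp
  then have ext: "independent I \<Longrightarrow> independent S \<and> card I \<le> card S" for I
    by (auto simp: extendable_def dest: subset_antisym)
  moreover have "independent {}" by (simp add: independent_def)
  ultimately show thesis using that S by blast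
qed

end

section \<open>Polynomial-time functions on trees\<close>

lemma poly_nat_mono: "x \<le> y \<Longrightarrow> poly p x \<le> poly p y" for p :: "nat poly"
  by (induction p) (auto intro!: add_mono mult_mono)

text \<open>
  A command \<open>c k\<close> takes its argument from variable \<open>k\<close>, returns its result there, uses the variables
  above \<open>k\<close> as scratch space, whatever they contain, and leaves those below \<open>k\<close> unchanged.
\<close>

definition implements :: "(vname \<Rightarrow> cmd) \<Rightarrow> nat poly \<Rightarrow> (val \<Rightarrow> val) \<Rightarrow> bool" where
  "implements c p f \<longleftrightarrow>
     (\<forall>k s. \<exists>t s'. exec (c k) s t s' \<and> t \<le> poly p (size (s k)) \<and> s' k = f (s k) \<and> (\<forall>j<k. s' j = s j))"

text \<open>The bound on the size of the result does not follow from the time bound, because of sharing.\<close>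

definition polytime :: "(val \<Rightarrow> val) \<Rightarrow> bool" where
  "polytime f \<longleftrightarrow> (\<exists>c p. implements c p f) \<and> (\<exists>q :: nat poly. \<forall>x. size (f x) \<le> poly q (size x))"

definition polytime_pred :: "(val \<Rightarrow> bool) \<Rightarrow> bool" where
  "polytime_pred P \<longleftrightarrow> polytime (\<lambda>x. enc_bool (P x))"

lemma enc_bool_eq_Leaf [simp]: "enc_bool b = Leaf \<longleftrightarrow> \<not> b"
  by (simp add: enc_bool_def)

lemma size_enc_bool: "size (enc_bool b) \<le> 1"
  by (simp add: enc_bool_def)

section \<open>Assignments, composition, pairing and branching\<close>

lemma exec_AssignI: "t = 1 + exp_cost a \<Longrightarrow> s' = s(x := eval_exp a s) \<Longrightarrow> exec (Assign x a) s t s'"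
  by (simp only: exec.Assign)

lemma polytime_expI:
  assumes "\<And>k s. eval_exp (e k) s = f (s k)" and "\<And>k. exp_cost (e k) \<le> n"
    and "\<And>x. size (f x) \<le> size x + m"
  shows "polytime f"
  unfolding polytime_def implements_def
proof (intro conjI exI allI impI)
  fix k s
  show "exec (Assign k (e k)) s (1 + exp_cost (e k)) (s(k := eval_exp (e k) s))"
    by (rule exec.Assign)
  show "1 + exp_cost (e k) \<le> poly [:1 + n:] (size (s k))" using assms(2) by simp
  show "(s(k := eval_exp (e k) s)) k = f (s k)" using assms(1) by simp
next
  show "size (f x) \<le> poly [:m, 1:] (size x)" for x
    using assms(3)[of x] by simp
qed simp_all

lemma polytime_id: "polytime (\<lambda>x. x)"
  by (rule polytime_expI[where e = Var and n = 1 and m = 0]) auto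

lemma polytime_Leaf: "polytime (\<lambda>x. Leaf)"
  by (rule polytime_expI[where e = "\<lambda>_. NilE" and n = 1 and m = 0]) auto

lemma size_left: "size (left x) \<le> size x" and size_right: "size (right x) \<le> size x"
  by (cases x; simp)+

text \<open>The size bound \<open>q\<close> of the first function limits the running time of the
  second, whence \<open>pcompose p' q\<close>.\<close>

lemma polytime_comp:
  assumes "polytime g" and "polytime f"
  shows "polytime (\<lambda>x. g (f x))"
proof -
  obtain c p q c' p' q' where f: "implements c p f" "\<And>x. size (f x) \<le> poly q (size x)"
    and g: "implements c' p' g" "\<And>x. size (g x) \<le> poly q' (size x)"
    using assms unfolding polytime_def by metis
  have "implements (\<lambda>k. Seq (c k) (c' k)) (p + pcompose p' q) (\<lambda>x. g (f x))"
    unfolding implements_def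
  proof (intro allI)
    fix k s
    obtain t s1 where 1: "exec (c k) s t s1" "t \<le> poly p (size (s k))" "s1 k = f (s k)" "\<forall>j<k. s1 j = s j"
      using f(1) unfolding implements_def by blast
    obtain u s2 where 2: "exec (c' k) s1 u s2" "u \<le> poly p' (size (s1 k))" "s2 k = g (s1 k)" "\<forall>j<k. s2 j = s1 j"
      using g(1) unfolding implements_def by blast
    have "u \<le> poly p' (poly q (size (s k)))"
      using 2(2) f(2)[of "s k"] poly_nat_mono order_trans 1(3) by metis
    then show "\<exists>t s'. exec (Seq (c k) (c' k)) s t s' \<and> t \<le> poly (p + pcompose p' q) (size (s k)) \<and>
        s' k = g (f (s k)) \<and> (\<forall>j<k. s' j = s j)"
      using 1 2 by (intro exI[of _ "t + u"] exI[of _ s2]) (auto simp: poly_pcompose intro: exec.Seq)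
  qed
  moreover have "size (g (f x)) \<le> poly (pcompose q' q) (size x)" for x
    using g(2)[of "f x"] f(2)[of x] poly_nat_mono order_trans unfolding poly_pcompose by metis
  ultimately show ?thesis unfolding polytime_def by blast
qed

lemma polytime_left: "polytime f \<Longrightarrow> polytime (\<lambda>x. left (f x))"
  by (rule polytime_comp, rule polytime_expI[where e = "\<lambda>k. Hd (Var k)" and n = 2 and m = 0])
    (auto simp: size_left)

lemma polytime_right: "polytime f \<Longrightarrow> polytime (\<lambda>x. right (f x))"
  by (rule polytime_comp, rule polytime_expI[where e = "\<lambda>k. Tl (Var k)" and n = 2 and m = 0])
    (auto simp: size_right)

text \<open>Running \<open>c\<close> at \<open>m\<close> on a copy keeps the argument in
  \<open>k\<close> available for further use. The 2 is the cost of copying.\<close>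

lemma exec_on_copy:
  assumes "implements c p f" and "k < m"
  obtains t s' where "exec (Seq (Assign m (Var k)) (c m)) s t s'" and "t \<le> 2 + poly p (size (s k))"
    and "s' m = f (s k)" and "\<And>j. j < m \<Longrightarrow> s' j = s j"
proof -
  obtain t s' where "exec (c m) (s(m := s k)) t s'" "t \<le> poly p (size (s k))" "s' m = f (s k)"
    "\<forall>j<m. s' j = (s(m := s k)) j"
    using assms(1) unfolding implements_def by (metis fun_upd_same)
  moreover have "exec (Assign m (Var k)) s 2 (s(m := s k))" by (rule exec_AssignI) auto
  ultimately show thesis using that[of "2 + t" s'] exec.Seq by fastforce
qed

lemma polytime_Node:
  assumes "polytime f" and "polytime g"
  shows "polytime (\<lambda>x. Node (f x) (g x))"
proof -
  obtain c p q c' p' q' where f: "implements c p f" "\<And>x. size (f x) \<le> poly q (size x)"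
    and g: "implements c' p' g" "\<And>x. size (g x) \<le> poly q' (size x)"
    using assms unfolding polytime_def by metis
  let ?c = "\<lambda>k :: vname. Seq (Seq (Assign (k+1) (Var k)) (c (k+1)))
      (Seq (Seq (Assign (k+2) (Var k)) (c' (k+2))) (Assign k (ConsE (Var (k+1)) (Var (k+2)))))"
  \<comment> \<open>8 is made up of two copies at cost 2 and the final assignment at cost 4.\<close>
  have "implements ?c (p + p' + [:8:]) (\<lambda>x. Node (f x) (g x))"
    unfolding implements_def
  proof (intro allI)
    fix k s
    obtain t s1 where 1: "exec (Seq (Assign (k+1) (Var k)) (c (k+1))) s t s1"
      "t \<le> 2 + poly p (size (s k))" "s1 (k+1) = f (s k)" "\<And>j. j < k+1 \<Longrightarrow> s1 j = s j"
      using exec_on_copy[OF f(1), of k "k+1" s] by auto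
    obtain u s2 where 2: "exec (Seq (Assign (k+2) (Var k)) (c' (k+2))) s1 u s2"
      "u \<le> 2 + poly p' (size (s1 k))" "s2 (k+2) = g (s1 k)" "\<And>j. j < k+2 \<Longrightarrow> s2 j = s1 j"
      using exec_on_copy[OF g(1), of k "k+2" s1] by auto
    have "exec (Assign k (ConsE (Var (k+1)) (Var (k+2)))) s2 4 (s2(k := Node (f (s k)) (g (s k))))"
      using 1 2 by (intro exec_AssignI) auto
    with 1(1) 2(1) have "exec (?c k) s (t + (u + 4)) (s2(k := Node (f (s k)) (g (s k))))"
      by (intro exec.Seq)
    then show "\<exists>t s'. exec (?c k) s t s' \<and> t \<le> poly (p + p' + [:8:]) (size (s k)) \<and>
        s' k = Node (f (s k)) (g (s k)) \<and> (\<forall>j<k. s' j = s j)"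
      using 1(2,4) 2(2,4)
      by (intro exI[of _ "t + (u + 4)"] exI[of _ "s2(k := Node (f (s k)) (g (s k)))"]) auto
  qed
  moreover have "size (Node (f x) (g x)) \<le> poly (q + q' + 1) (size x)" for x
    using f(2)[of x] g(2)[of x] by simp
  ultimately show ?thesis unfolding polytime_def by blast
qed

lemma polytime_If:
  assumes "polytime_pred P" and "polytime f" and "polytime g"
  shows "polytime (\<lambda>x. if P x then f x else g x)"
proof -
  obtain b r c p q c' p' q' where b: "implements b r (\<lambda>x. enc_bool (P x))"
    and f: "implements c p f" "\<And>x. size (f x) \<le> poly q (size x)"
    and g: "implements c' p' g" "\<And>x. size (g x) \<le> poly q' (size x)"
    using assms unfolding polytime_def polytime_pred_def by metis
  let ?h = "\<lambda>x. if P x then f x else g x"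
  let ?c = "\<lambda>k :: vname. Seq (Seq (Assign (k+1) (Var k)) (b (k+1))) (Cond (Var (k+1)) (c k) (c' k))"
  \<comment> \<open>4 pays for copying the argument and for the test; \<open>p + p'\<close> covers
    whichever branch is taken.\<close>
  have "implements ?c (r + p + p' + [:4:]) ?h"
    unfolding implements_def
  proof (intro allI)
    fix k s
    obtain t s1 where 1: "exec (Seq (Assign (k+1) (Var k)) (b (k+1))) s t s1"
      "t \<le> 2 + poly r (size (s k))" "s1 (k+1) = enc_bool (P (s k))" "\<And>j. j < k+1 \<Longrightarrow> s1 j = s j"
      using exec_on_copy[OF b, of k "k+1" s] by auto
    have "\<exists>u s'. exec (Cond (Var (k+1)) (c k) (c' k)) s1 (2 + u) s' \<and>
        u \<le> poly p (size (s k)) + poly p' (size (s k)) \<and> s' k = ?h (s k) \<and> (\<forall>j<k. s' j = s1 j)"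
    proof (cases "P (s k)")
      case True
      obtain u s2 where 2: "exec (c k) s1 u s2" "u \<le> poly p (size (s1 k))" "s2 k = f (s1 k)" "\<forall>j<k. s2 j = s1 j"
        using f(1) unfolding implements_def by blast
      have "exec (Cond (Var (k+1)) (c k) (c' k)) s1 (1 + exp_cost (Var (k+1)) + u) s2"
        by (rule exec.CondTrue) (use True 1(3) 2(1) in auto)
      with 2 1(4) True show ?thesis by (intro exI[of _ u] exI[of _ s2]) auto
    next
      case False
      obtain u s2 where 2: "exec (c' k) s1 u s2" "u \<le> poly p' (size (s1 k))" "s2 k = g (s1 k)" "\<forall>j<k. s2 j = s1 j"
        using g(1) unfolding implements_def by blast
      have "exec (Cond (Var (k+1)) (c k) (c' k)) s1 (1 + exp_cost (Var (k+1)) + u) s2"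
        by (rule exec.CondFalse) (use False 1(3) 2(1) in auto)
      with 2 1(4) False show ?thesis by (intro exI[of _ u] exI[of _ s2]) auto
    qed
    then obtain u s2 where 2: "exec (Cond (Var (k+1)) (c k) (c' k)) s1 (2 + u) s2"
        "u \<le> poly p (size (s k)) + poly p' (size (s k))" "s2 k = ?h (s k)" "\<forall>j<k. s2 j = s1 j" by blast
    from exec.Seq[OF 1(1) 2(1)] show "\<exists>t s'. exec (?c k) s t s' \<and>
        t \<le> poly (r + p + p' + [:4:]) (size (s k)) \<and> s' k = ?h (s k) \<and> (\<forall>j<k. s' j = s j)"
      using 1(2,4) 2(2-4) by (intro exI[of _ "t + (2 + u)"] exI[of _ s2]) auto
  qed
  moreover have "size (?h x) \<le> poly (q + q') (size x)" for x
    using f(2)[of x] g(2)[of x] by auto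
  ultimately show ?thesis unfolding polytime_def by blast
qed

section \<open>Iteration over the items of a list\<close>

fun items :: "val \<Rightarrow> val list" where
  "items Leaf = []"
| "items (Node x xs) = x # items xs"

lemma items_enc_list [simp]: "items (enc_list xs) = xs"
  by (induction xs) auto

text \<open>An item \<open>y\<close> contributes \<open>size y + 1\<close> to \<open>size l\<close>,
  so the factor \<open>n + 1\<close> pays for a growth of \<open>size y + n\<close> per
  round.\<close>

lemma size_foldl_items:
  assumes "\<And>a y. size (g a y) \<le> size a + size y + n"
  shows "size (foldl g a (items l)) \<le> size a + (n + 1) * size l"
proof (induction l arbitrary: a)
  case (Node y l)
  have "size (foldl g (g a y) (items l)) \<le> size (g a y) + (n + 1) * size l" by (rule Node.IH)
  also have "\<dots> \<le> size a + size y + n + (n + 1) * size l" using assms[of a y] by simp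
  also have "\<dots> \<le> size a + (n + 1) * size (Node y l)" by (simp add: algebra_simps)
  finally show ?case by simp
qed simp

text \<open>Variable \<open>k\<close> holds the environment, \<open>k+1\<close> the accumulator,
  \<open>k+2\<close> the rest of the list and \<open>k+3\<close> the packed triple for
  \<open>c\<close>. The quantity bounded by \<open>B\<close> never increases: consuming
  \<open>y\<close> releases \<open>(n + 1) * (size y + 1)\<close>, which covers the growth of the
  accumulator. Besides \<open>c\<close>, a round costs 14: 2 for the test, 7 for packing, 2 for
  storing the result and 3 for advancing.\<close>

lemma exec_foldl_loop:
  fixes p :: "nat poly"
  assumes c: "implements c p (\<lambda>z. g (left z) (left (right z)) (right (right z)))"
    and growth: "\<And>x a y. size (g x a y) \<le> size a + size y + n"
    and bound: "size (s (k+1)) + (n + 1) * size (s (k+2)) \<le> B"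
  shows "\<exists>t s'. exec (While (Var (k+2)) (Seq (Assign (k+3) (ConsE (Var k) (ConsE (Var (k+1)) (Hd (Var (k+2))))))
      (Seq (c (k+3)) (Seq (Assign (k+1) (Var (k+3))) (Assign (k+2) (Tl (Var (k+2)))))))) s t s' \<and>
    t \<le> 2 + size (s (k+2)) * (14 + poly p (size (s k) + 2 * B + 2)) \<and>
    s' (k+1) = foldl (g (s k)) (s (k+1)) (items (s (k+2))) \<and> (\<forall>j\<le>k. s' j = s j)"
    (is "\<exists>t s'. exec (While _ ?body) s t s' \<and> _")
  using bound
proof (induction "s (k+2)" arbitrary: s)
  case Leaf
  have "exec (While (Var (k+2)) ?body) s (1 + exp_cost (Var (k+2))) s"
    by (rule exec.WhileFalse) (use Leaf in simp)
  then show ?case using Leaf(1)[symmetric] by (intro exI[of _ "1 + exp_cost (Var (k+2))"] exI[of _ s]) auto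
next
  case (Node y l)
  note l = Node(3)[symmetric]
  let ?z = "Node (s k) (Node (s (k+1)) y)"
  let ?s1 = "s(k+3 := ?z)"
  have 1: "exec (Assign (k+3) (ConsE (Var k) (ConsE (Var (k+1)) (Hd (Var (k+2)))))) s 7 ?s1"
    using l by (intro exec_AssignI) auto
  obtain t s2 where 2: "exec (c (k+3)) ?s1 t s2" "t \<le> poly p (size ?z)" "s2 (k+3) = g (s k) (s (k+1)) y"
    "\<forall>j<k+3. s2 j = ?s1 j"
    using c[unfolded implements_def, rule_format, of "k+3" ?s1] by auto
  let ?s3 = "s2(k+1 := g (s k) (s (k+1)) y)"
  let ?s4 = "?s3(k+2 := l)"
  have 3: "exec (Assign (k+1) (Var (k+3))) s2 2 ?s3"
    using 2(3) by (intro exec_AssignI) auto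
  have 4: "exec (Assign (k+2) (Tl (Var (k+2)))) ?s3 3 ?s4"
    using 2(4) l by (intro exec_AssignI) auto
  have body: "exec ?body s (7 + (t + (2 + 3))) ?s4"
    by (intro exec.Seq[OF 1] exec.Seq[OF 2(1)] exec.Seq[OF 3] 4)
  have vals: "?s4 (k+1) = g (s k) (s (k+1)) y" "?s4 (k+2) = l" "?s4 k = s k" "\<forall>j\<le>k. ?s4 j = s j"
    using 2(4) by auto
  have B: "size (s (k+1)) + (n + 1) * (size y + size l + 1) \<le> B" using Node.prems l by simp
  have "size (g (s k) (s (k+1)) y) + (n + 1) * size l \<le> size (s (k+1)) + size y + n + (n + 1) * size l"
    using growth[of "s k" "s (k+1)" y] by simp
  also have "\<dots> \<le> B" using B by (simp add: algebra_simps)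
  finally have "size (?s4 (k+1)) + (n + 1) * size (?s4 (k+2)) \<le> B" using vals by simp
  from Node(2)[of ?s4, OF vals(2)[symmetric] this] obtain u s5 where
    5: "exec (While (Var (k+2)) ?body) ?s4 u s5"
    and u: "u \<le> 2 + size (?s4 (k+2)) * (14 + poly p (size (?s4 k) + 2 * B + 2))"
    and r: "s5 (k+1) = foldl (g (?s4 k)) (?s4 (k+1)) (items (?s4 (k+2)))"
    and frame: "\<forall>j\<le>k. s5 j = ?s4 j"
    by blast
  have "size (s (k+1)) \<le> B" "size y \<le> B" using B by (simp_all add: algebra_simps)
  then have "size ?z \<le> size (s k) + 2 * B + 2" by simp
  then have t: "t \<le> poly p (size (s k) + 2 * B + 2)" using 2(2) poly_nat_mono order_trans by blast
  have "exec (While (Var (k+2)) ?body) s (1 + exp_cost (Var (k+2)) + (7 + (t + (2 + 3))) + u) s5"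
    by (rule exec.WhileTrue[OF _ body 5]) (use l in simp)
  moreover have "1 + exp_cost (Var (k+2)) + (7 + (t + (2 + 3))) + u
      \<le> 2 + size (s (k+2)) * (14 + poly p (size (s k) + 2 * B + 2))"
    using t u[unfolded vals] l by (simp add: algebra_simps)
  moreover have "s5 (k+1) = foldl (g (s k)) (s (k+1)) (items (s (k+2)))" using r[unfolded vals] l by simp
  moreover have "\<forall>j\<le>k. s5 j = s j" using frame vals(4) by simp
  ultimately show ?case by blast
qed

lemma polytime_foldl:
  assumes "polytime (\<lambda>z. g (left z) (left (right z)) (right (right z)))"
    and "polytime a" and "polytime l"
    and growth: "\<And>x a y. size (g x a y) \<le> size a + size y + n"
  shows "polytime (\<lambda>x. foldl (g x) (a x) (items (l x)))"
proof -
  obtain c p c1 p1 q1 c2 p2 q2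
    where c: "implements c p (\<lambda>z. g (left z) (left (right z)) (right (right z)))"
      and a: "implements c1 p1 a" "\<And>x. size (a x) \<le> poly q1 (size x)"
      and l: "implements c2 p2 l" "\<And>x. size (l x) \<le> poly q2 (size x)"
    using assms unfolding polytime_def by metis
  let ?h = "\<lambda>x. foldl (g x) (a x) (items (l x))"
  let ?body = "\<lambda>k :: vname. Seq (Assign (k+3) (ConsE (Var k) (ConsE (Var (k+1)) (Hd (Var (k+2))))))
      (Seq (c (k+3)) (Seq (Assign (k+1) (Var (k+3))) (Assign (k+2) (Tl (Var (k+2))))))"
  let ?c = "\<lambda>k :: vname. Seq (Seq (Assign (k+1) (Var k)) (c1 (k+1))) (Seq (Seq (Assign (k+2) (Var k)) (c2 (k+2)))
      (Seq (While (Var (k+2)) (?body k)) (Assign k (Var (k+1)))))"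
  let ?b = "q1 + smult (n + 1) q2"
  \<comment> \<open>8 is 2 for each of the two copies, the last loop test and the final
    assignment.\<close>
  let ?p = "p1 + p2 + [:8:] + q2 * ([:14:] + pcompose p ([:2, 1:] + smult 2 ?b))"
  have "implements ?c ?p ?h"
    unfolding implements_def
  proof (intro allI)
    fix k :: vname and s :: state
    let ?x = "s k"
    obtain t s1 where 1: "exec (Seq (Assign (k+1) (Var k)) (c1 (k+1))) s t s1"
      "t \<le> 2 + poly p1 (size ?x)" "s1 (k+1) = a ?x" "\<And>j. j < k+1 \<Longrightarrow> s1 j = s j"
      using exec_on_copy[OF a(1), of k "k+1" s] by auto
    obtain u s2 where 2: "exec (Seq (Assign (k+2) (Var k)) (c2 (k+2))) s1 u s2"
      "u \<le> 2 + poly p2 (size (s1 k))" "s2 (k+2) = l (s1 k)" "\<And>j. j < k+2 \<Longrightarrow> s2 j = s1 j"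
      using exec_on_copy[OF l(1), of k "k+2" s1] by auto
    have v: "s2 k = ?x" "s2 (k+1) = a ?x" "s2 (k+2) = l ?x" "\<forall>j<k. s2 j = s j"
      using 1 2 by auto
    let ?B = "poly ?b (size ?x)"
    have "size (a ?x) + (n + 1) * size (l ?x) \<le> ?B"
      unfolding poly_add poly_smult by (intro add_mono mult_le_mono2 a(2) l(2))
    then have "size (s2 (k+1)) + (n + 1) * size (s2 (k+2)) \<le> ?B" using v by simp
    from exec_foldl_loop[OF c growth this] obtain w s3 where
      3: "exec (While (Var (k+2)) (?body k)) s2 w s3"
      "w \<le> 2 + size (s2 (k+2)) * (14 + poly p (size (s2 k) + 2 * ?B + 2))"
      "s3 (k+1) = foldl (g (s2 k)) (s2 (k+1)) (items (s2 (k+2)))" "\<forall>j\<le>k. s3 j = s2 j"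
      by blast
    have 4: "exec (Assign k (Var (k+1))) s3 2 (s3(k := ?h ?x))"
      using 3(3) v by (intro exec_AssignI) auto
    have "exec (?c k) s (t + (u + (w + 2))) (s3(k := ?h ?x))"
      by (intro exec.Seq[OF 1(1)] exec.Seq[OF 2(1)] exec.Seq[OF 3(1)] 4)
    moreover have "t + (u + (w + 2)) \<le> poly ?p (size ?x)"
    proof -
      have "size (l ?x) * (14 + poly p (size ?x + 2 * ?B + 2))
          \<le> poly q2 (size ?x) * (14 + poly p (size ?x + 2 * ?B + 2))"
        by (intro mult_le_mono1 l(2))
      then have "w \<le> 2 + poly q2 (size ?x) * (14 + poly p (size ?x + 2 * ?B + 2))"
        using 3(2)[unfolded v] by linarith
      moreover have "u \<le> 2 + poly p2 (size ?x)" using 1(4) 2(2) by simp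
      moreover have "poly ?p (size ?x) = poly p1 (size ?x) + poly p2 (size ?x) + 8
          + poly q2 (size ?x) * (14 + poly p (size ?x + 2 * ?B + 2))"
        by (simp add: poly_pcompose add_ac)
      ultimately show ?thesis using 1(2) by linarith
    qed
    moreover have "\<forall>j<k. (s3(k := ?h ?x)) j = s j" using 3(4) v(4) by auto
    ultimately show "\<exists>t s'. exec (?c k) s t s' \<and> t \<le> poly ?p (size ?x) \<and> s' k = ?h ?x \<and> (\<forall>j<k. s' j = s j)"
      by (intro exI[of _ "t + (u + (w + 2))"] exI[of _ "s3(k := ?h ?x)"]) auto
  qed
  moreover have "size (?h x) \<le> poly ?b (size x)" for x
  proof -
    have "size (?h x) \<le> size (a x) + (n + 1) * size (l x)" by (rule size_foldl_items[OF growth])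
    also have "\<dots> \<le> poly ?b (size x)"
      unfolding poly_add poly_smult by (intro add_mono mult_le_mono2 a(2) l(2))
    finally show ?thesis .
  qed
  ultimately show ?thesis unfolding polytime_def by blast
qed

section \<open>Predicates and bounded quantifiers\<close>

lemma polytime_pred_nonleaf:
  assumes "polytime f"
  shows "polytime_pred (\<lambda>x. f x \<noteq> Leaf)"
proof -
  \<comment> \<open>\<open>items\<close> reads every tree as a list, empty only for
    \<open>Leaf\<close>, and the fold overwrites its start value as soon as there is an item. This
    provides a first test for \<open>polytime_If\<close>.\<close>
  have "polytime (\<lambda>x. foldl (\<lambda>_ _. Node Leaf Leaf) Leaf (items (f x)))"
    by (rule polytime_foldl[where n = 1]) (auto intro: polytime_Node polytime_Leaf assms)
  moreover have "foldl (\<lambda>_ _. Node Leaf Leaf) a (items v) = (if v \<noteq> Leaf then Node Leaf Leaf else a)" for a v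
    by (induction v arbitrary: a) auto
  ultimately show ?thesis by (simp add: polytime_pred_def enc_bool_def)
qed

lemma polytime_pred_conj:
  assumes "polytime_pred P" and "polytime_pred Q"
  shows "polytime_pred (\<lambda>x. P x \<and> Q x)"
proof -
  have "polytime (\<lambda>x. if P x then enc_bool (Q x) else Leaf)"
    by (intro polytime_If assms(1) assms(2)[unfolded polytime_pred_def] polytime_Leaf)
  moreover have "(\<lambda>x. if P x then enc_bool (Q x) else Leaf) = (\<lambda>x. enc_bool (P x \<and> Q x))"
    by (auto simp: enc_bool_def)
  ultimately show ?thesis by (simp add: polytime_pred_def)
qed

lemma polytime_pred_not:
  assumes "polytime_pred P"
  shows "polytime_pred (\<lambda>x. \<not> P x)"
proof -
  have "polytime (\<lambda>x. if P x then Leaf else Node Leaf Leaf)"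
    by (intro polytime_If polytime_Leaf polytime_Node assms)
  moreover have "(\<lambda>x. if P x then Leaf else Node Leaf Leaf) = (\<lambda>x. enc_bool (\<not> P x))"
    by (auto simp: enc_bool_def)
  ultimately show ?thesis by (simp add: polytime_pred_def)
qed

lemma polytime_pred_disj:
  assumes "polytime_pred P" and "polytime_pred Q"
  shows "polytime_pred (\<lambda>x. P x \<or> Q x)"
  using polytime_pred_not[OF polytime_pred_conj[OF assms[THEN polytime_pred_not]]] by simp

lemma polytime_pred_imp:
  assumes "polytime_pred P" and "polytime_pred Q"
  shows "polytime_pred (\<lambda>x. P x \<longrightarrow> Q x)"
  unfolding imp_conv_disj by (intro polytime_pred_disj polytime_pred_not assms)

lemma polytime_pred_comp:
  "polytime_pred P \<Longrightarrow> polytime f \<Longrightarrow> polytime_pred (\<lambda>x. P (f x))"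
  unfolding polytime_pred_def by (rule polytime_comp)

lemma polytime_pred_Bex:
  assumes P: "polytime_pred (\<lambda>z. P (left z) (right z))" and l: "polytime l"
  shows "polytime_pred (\<lambda>x. \<exists>y\<in>set (items (l x)). P x y)"
proof -
  let ?g = "\<lambda>x a y. enc_bool (a \<noteq> Leaf \<or> P x y)"
  have "polytime_pred (\<lambda>z. P (left z) (right (right z)))"
    using polytime_pred_comp[OF P, of "\<lambda>z. Node (left z) (right (right z))"]
    by (simp add: polytime_Node polytime_left polytime_right polytime_id)
  then have "polytime (\<lambda>z. ?g (left z) (left (right z)) (right (right z)))"
    unfolding polytime_pred_def[symmetric]
    by (intro polytime_pred_disj polytime_pred_nonleaf polytime_left polytime_right polytime_id)
  then have "polytime (\<lambda>x. foldl (?g x) Leaf (items (l x)))"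
    by (rule polytime_foldl[where n = 1]) (auto intro: polytime_Leaf l order_trans[OF size_enc_bool])
  moreover have "foldl (?g x) (enc_bool b) ys = enc_bool (b \<or> (\<exists>y\<in>set ys. P x y))" for x b ys
    by (induction ys arbitrary: b) (auto intro!: arg_cong[where f = enc_bool])
  from this[of _ False] have "foldl (?g x) Leaf ys = enc_bool (\<exists>y\<in>set ys. P x y)" for x ys
    by (simp add: enc_bool_def)
  ultimately show ?thesis by (simp add: polytime_pred_def)
qed

lemma polytime_pred_Ball:
  assumes P: "polytime_pred (\<lambda>z. P (left z) (right z))" and l: "polytime l"
  shows "polytime_pred (\<lambda>x. \<forall>y\<in>set (items (l x)). P x y)"
  using polytime_pred_not[OF polytime_pred_Bex[OF polytime_pred_not[OF P] l]] by simp

section \<open>List functions\<close>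

lemma polytime_rev:
  assumes "polytime l"
  shows "polytime (\<lambda>x. enc_list (rev (items (l x))))"
proof -
  have "polytime (\<lambda>z. Node (right (right z)) (left (right z)))"
    by (intro polytime_Node polytime_left polytime_right polytime_id)
  then have "polytime (\<lambda>x. foldl (\<lambda>a y. Node y a) Leaf (items (l x)))"
    by (rule polytime_foldl[where n = 1]) (auto intro: polytime_Leaf assms)
  moreover have "foldl (\<lambda>a y. Node y a) (enc_list zs) ys = enc_list (rev ys @ zs)" for zs ys
    by (induction ys arbitrary: zs) (auto simp flip: enc_list.simps(2))
  from this[of "[]"] have "foldl (\<lambda>a y. Node y a) Leaf ys = enc_list (rev ys)" for ys by simp
  ultimately show ?thesis by simp
qed

text \<open>The fold pushes results onto the front and so builds the list in reverse;
  \<open>polytime_rev\<close> restores the order. In \<open>n + 1\<close> the 1 is the new list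
  cell.\<close>

lemma polytime_map:
  assumes f: "polytime (\<lambda>z. f (left z) (right z))" and l: "polytime l"
    and growth: "\<And>x y. size (f x y) \<le> size y + n"
  shows "polytime (\<lambda>x. enc_list (map (f x) (items (l x))))"
proof -
  have "polytime (\<lambda>z. f (left z) (right (right z)))"
    using polytime_comp[OF f, of "\<lambda>z. Node (left z) (right (right z))"]
    by (simp add: polytime_Node polytime_left polytime_right polytime_id)
  then have "polytime (\<lambda>z. Node (f (left z) (right (right z))) (left (right z)))"
    by (intro polytime_Node polytime_left polytime_right polytime_id)
  then have "polytime (\<lambda>x. foldl (\<lambda>a y. Node (f x y) a) Leaf (items (l x)))"
    by (rule polytime_foldl[where n = "n + 1"]) (auto intro: polytime_Leaf l growth)
  moreover have "foldl (\<lambda>a y. Node (f x y) a) (enc_list zs) ys = enc_list (rev (map (f x) ys) @ zs)" for x zs ys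
    by (induction ys arbitrary: zs) (auto simp flip: enc_list.simps(2))
  from this[of _ "[]"] have "foldl (\<lambda>a y. Node (f x y) a) Leaf ys = enc_list (rev (map (f x) ys))" for x ys
    by simp
  ultimately have "polytime (\<lambda>x. enc_list (rev (map (f x) (items (l x)))))" by simp
  from polytime_rev[OF this] show ?thesis by simp
qed

lemma polytime_snoc:
  assumes "polytime l" and "polytime f"
  shows "polytime (\<lambda>x. enc_list (items (l x) @ [f x]))"
  using polytime_rev[OF polytime_Node[OF assms(2) polytime_rev[OF assms(1)]]] by simp

lemma polytime_imp_solvable:
  assumes "polytime f" and "\<And>i. I i \<Longrightarrow> sol i (f (enc i))"
  shows "solvable_in_polytime I enc sol"
proof -
  obtain c p where c: "implements c p f" using assms(1) by (auto simp: polytime_def)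
  have "\<exists>t. runs (c 0) x t (f x) \<and> t \<le> poly p (size x)" for x
    using c[unfolded implements_def, rule_format, of 0 "(\<lambda>_. Leaf)(0 := x)"]
    by (auto simp: runs_def)
  then show ?thesis unfolding solvable_in_polytime_def using assms(2) by metis
qed

section \<open>The greedy algorithm on incidence matrices\<close>

text \<open>A fold traverses one list only, so the accumulator pairs a flag on the left with the
  unread rest of \<open>y\<close>, which advances in step with \<open>x\<close>.\<close>

definition row_meets :: "val \<Rightarrow> val \<Rightarrow> bool" where
  "row_meets x y \<longleftrightarrow> left (foldl (\<lambda>a b. Node (enc_bool (left a \<noteq> Leaf \<or> b \<noteq> Leaf \<and> left (right a) \<noteq> Leaf))
     (right (right a))) (Node Leaf y) (items x)) \<noteq> Leaf"

definition row_conflict :: "val \<Rightarrow> val \<Rightarrow> val \<Rightarrow> bool" where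
  "row_conflict E x y \<longleftrightarrow> (\<exists>h\<in>set (items E). row_meets h x \<and> row_meets h y)"

text \<open>
  The state of the algorithm lists pairs \<open>Node r s\<close> of a row \<open>r\<close> and a status \<open>s\<close>, which is
  \<open>Node (Node Leaf Leaf) Leaf\<close> for undecided, \<open>Node Leaf Leaf\<close> for chosen and \<open>Leaf\<close> for discarded
  hyperedges. The status never grows, and on decided hyperedges it is the output bit.
\<close>

definition undecided :: "val \<Rightarrow> bool" where
  "undecided y \<longleftrightarrow> left (right y) \<noteq> Leaf"

text \<open>The concrete form of the test in \<open>greedy_step\<close>, with the head of
  \<open>l\<close> as candidate. As in \<open>simplicial\<close>, \<open>f\<close> and
  \<open>g\<close> may be the candidate itself.\<close>

definition selectable :: "val \<Rightarrow> val \<Rightarrow> bool" where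
  "selectable E l \<longleftrightarrow> undecided (left l) \<and>
     (\<forall>f\<in>set (items l). \<forall>g\<in>set (items l). undecided f \<longrightarrow> undecided g \<longrightarrow>
        row_conflict E (left (left l)) (left f) \<longrightarrow> row_conflict E (left (left l)) (left g) \<longrightarrow>
        row_conflict E (left f) (left g))"

definition discard :: "val \<Rightarrow> val \<Rightarrow> val \<Rightarrow> val" where
  "discard E l y = (if selectable E l \<and> undecided y \<and> row_conflict E (left (left l)) (left y)
     then Node (left y) Leaf else y)"

text \<open>
  Rotating the list replaces the use of indices: a pass of as many steps as there are hyperedges
  treats each of them once and restores the order.
\<close>

definition step :: "val \<Rightarrow> val \<Rightarrow> val" where
  "step E l = (if l \<noteq> Leaf then
     enc_list (items (enc_list (map (discard E l) (items (right l)))) @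
       [if selectable E l then Node (left (left l)) (Node Leaf Leaf) else left l])
     else Leaf)"

text \<open>The fold ignores the rows it visits; their number acts as a loop counter. The same
  device in \<open>algorithm\<close> yields the number of passes required by
  \<open>greedy_exhausts\<close>.\<close>

definition pass :: "val \<Rightarrow> val \<Rightarrow> val" where
  "pass E l = foldl (\<lambda>a _. step E a) l (items E)"

definition algorithm :: "val \<Rightarrow> val" where
  "algorithm x = (let E = right x in
     enc_list (map right (items (foldl (\<lambda>a _. pass E a)
       (enc_list (map (\<lambda>r. Node r (Node (Node Leaf Leaf) Leaf)) (items E))) (items E)))))"

subsection \<open>Running time\<close>

lemmas polytime_intros = polytime_id polytime_Leaf polytime_left polytime_right polytime_Node
  polytime_pred_conj polytime_pred_disj polytime_pred_imp polytime_pred_not polytime_pred_nonleaf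

lemma polytime_row_meets:
  assumes f: "polytime f" and g: "polytime g"
  shows "polytime_pred (\<lambda>x. row_meets (f x) (g x))"
  unfolding row_meets_def
proof (intro polytime_pred_nonleaf polytime_left)
  show "polytime (\<lambda>x. foldl (\<lambda>a b. Node (enc_bool (left a \<noteq> Leaf \<or> b \<noteq> Leaf \<and> left (right a) \<noteq> Leaf))
     (right (right a))) (Node Leaf (g x)) (items (f x)))"
  proof (rule polytime_foldl[where n = 2, OF _ _ f])
    show "polytime (\<lambda>x. Node Leaf (g x))" by (intro polytime_Node polytime_Leaf g)
    show "polytime (\<lambda>z. Node (enc_bool (left (left (right z)) \<noteq> Leaf \<or> right (right z) \<noteq> Leaf \<and>
        left (right (left (right z))) \<noteq> Leaf)) (right (right (left (right z)))))"
      by (rule polytime_Node, unfold polytime_pred_def[symmetric]) (intro polytime_intros)+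
    fix a y
    show "size (Node (enc_bool (left a \<noteq> Leaf \<or> y \<noteq> Leaf \<and> left (right a) \<noteq> Leaf)) (right (right a)))
        \<le> size a + size y + 2"
      using size_right[of "right a"] size_right[of a] by (simp add: enc_bool_def)
  qed
qed

lemma polytime_row_conflict:
  assumes "polytime E" and "polytime f" and "polytime g"
  shows "polytime_pred (\<lambda>x. row_conflict (E x) (f x) (g x))"
  unfolding row_conflict_def
  by (rule polytime_pred_Bex[OF _ assms(1)])
    (intro polytime_pred_conj polytime_row_meets polytime_right polytime_id
      polytime_comp[OF assms(2)] polytime_comp[OF assms(3)] polytime_left)

lemma polytime_undecided: "polytime f \<Longrightarrow> polytime_pred (\<lambda>x. undecided (f x))"
  unfolding undecided_def by (intro polytime_intros)

lemma polytime_selectable: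
  assumes "polytime E" and "polytime l"
  shows "polytime_pred (\<lambda>x. selectable (E x) (l x))"
  unfolding selectable_def
  by (intro polytime_pred_conj polytime_pred_Ball polytime_pred_imp polytime_undecided
      polytime_row_conflict polytime_left polytime_right polytime_id
      polytime_comp[OF assms(1)] polytime_comp[OF assms(2)] assms)

lemma size_discard: "size (discard E l y) \<le> size y"
  unfolding discard_def undecided_def by (cases y) auto

lemma polytime_discard:
  assumes "polytime E" and "polytime l" and "polytime f"
  shows "polytime (\<lambda>x. discard (E x) (l x) (f x))"
  unfolding discard_def
  by (intro polytime_If polytime_pred_conj polytime_selectable polytime_undecided
      polytime_row_conflict polytime_left polytime_Node polytime_Leaf assms)

lemma polytime_step:
  assumes "polytime E" and "polytime l"
  shows "polytime (\<lambda>x. step (E x) (l x))"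
  unfolding step_def
proof (intro polytime_If polytime_snoc)
  show "polytime (\<lambda>x. enc_list (map (discard (E x) (l x)) (items (right (l x)))))"
  proof (rule polytime_map[where n = 0])
    show "polytime (\<lambda>z. discard (E (left z)) (l (left z)) (right z))"
      by (intro polytime_discard polytime_comp[OF assms(1)] polytime_comp[OF assms(2)]
          polytime_left polytime_right polytime_id)
    show "polytime (\<lambda>x. right (l x))" by (intro polytime_right assms)
  qed (simp add: size_discard)
  show "polytime_pred (\<lambda>x. l x \<noteq> Leaf)" by (intro polytime_intros assms)
  show "polytime_pred (\<lambda>x. selectable (E x) (l x))" by (intro polytime_selectable assms)
qed (intro polytime_intros assms)+

lemma size_enc_list_append: "size (enc_list (xs @ ys)) = size (enc_list xs) + size (enc_list ys)"
  by (induction xs) auto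

lemma size_map_discard: "size (enc_list (map (discard E l) (items v))) \<le> size v"
proof (induction v)
  case (Node y v)
  then show ?case using size_discard[of E l y] by simp
qed simp

text \<open>A constant growth per step would not do: a pass has as many steps as there are rows, so
  its growth would depend on their number, while \<open>polytime_foldl\<close> allows the fold over
  passes only a constant besides the item size.\<close>

lemma size_step: "size (step E l) \<le> size l"
proof (cases l)
  case (Node y v)
  have "size (if selectable E l then Node (left y) (Node Leaf Leaf) else y) \<le> size y"
  proof (cases "selectable E l")
    case True
    \<comment> \<open>So the status of the head has size at least 2, whereas the status for chosen
      has size 1.\<close>
    then have "left (right y) \<noteq> Leaf" by (simp add: selectable_def undecided_def Node)
    then show ?thesis by (cases y; cases "right y"; cases "left (right y)") auto
  qed simp
  then show ?thesis
    using size_map_discard[of E l v] 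
    by (cases "selectable E l") (simp_all add: step_def Node size_enc_list_append)
qed (simp add: step_def)

lemma size_pass: "size (pass E l) \<le> size l"
proof -
  have "size (foldl (\<lambda>a _. step E a) l ys) \<le> size l" for ys :: "val list"
    by (induction ys arbitrary: l) (auto intro: order_trans size_step)
  then show ?thesis by (simp add: pass_def)
qed

lemma polytime_pass:
  assumes "polytime E" and "polytime l"
  shows "polytime (\<lambda>x. pass (E x) (l x))"
  unfolding pass_def
proof (rule polytime_foldl[where n = 0, OF _ assms(2,1)])
  show "polytime (\<lambda>z. step (E (left z)) (left (right z)))"
    by (intro polytime_step polytime_comp[OF assms(1)] polytime_intros)
  show "size (step (E x) a) \<le> size a + size y + 0" for x a y
    using size_step[of "E x" a] by simp
qed

lemma polytime_algorithm: "polytime algorithm"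
proof -
  let ?l = "\<lambda>x. enc_list (map (\<lambda>r. Node r (Node (Node Leaf Leaf) Leaf)) (items (right x)))"
  let ?m = "\<lambda>x. foldl (\<lambda>a _. pass (right x) a) (?l x) (items (right x))"
  have "polytime ?l"
    \<comment> \<open>3 is the size 2 of the undecided status plus the node that pairs it with the
      row.\<close>
    by (rule polytime_map[where n = 3]) (intro polytime_intros | simp)+
  then have "polytime ?m"
  proof (rule polytime_foldl[where n = 0, rotated])
    show "polytime right" by (intro polytime_intros)
    show "polytime (\<lambda>z. pass (right (left z)) (left (right z)))"
      by (intro polytime_pass polytime_intros)
    show "size (pass (right x) a) \<le> size a + size y + 0" for x a y
      using size_pass[of "right x" a] by simp
  qed
  moreover have "polytime (\<lambda>z. right (right z))" by (intro polytime_intros)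
  ultimately have "polytime (\<lambda>x. enc_list (map right (items (?m x))))"
    by (intro polytime_map[where n = 0]) (auto simp: size_right)
  then show ?thesis by (simp add: algorithm_def[abs_def] Let_def)
qed

subsection \<open>Correctness\<close>

lemma row_meets_enc:
  "row_meets (enc_list (map (\<lambda>v. enc_bool (P v)) vs)) (enc_list (map (\<lambda>v. enc_bool (Q v)) vs))
    \<longleftrightarrow> (\<exists>v\<in>set vs. P v \<and> Q v)"
proof -
  let ?g = "\<lambda>a b. Node (enc_bool (left a \<noteq> Leaf \<or> b \<noteq> Leaf \<and> left (right a) \<noteq> Leaf)) (right (right a))"
  have "foldl ?g (Node (enc_bool c) (enc_list (map (\<lambda>v. enc_bool (Q v)) vs))) (map (\<lambda>v. enc_bool (P v)) vs)
      = Node (enc_bool (c \<or> (\<exists>v\<in>set vs. P v \<and> Q v))) Leaf" for c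
  proof (induction vs arbitrary: c)
    case (Cons v vs)
    have "?g (Node (enc_bool c) (enc_list (map (\<lambda>v. enc_bool (Q v)) (v # vs)))) (enc_bool (P v))
        = Node (enc_bool (c \<or> P v \<and> Q v)) (enc_list (map (\<lambda>v. enc_bool (Q v)) vs))"
      by simp
    then show ?case
      using Cons[of "c \<or> P v \<and> Q v"] by (simp only: list.map foldl_Cons) (simp add: disj_assoc)
  qed simp
  from this[of False] show ?thesis
    unfolding row_meets_def items_enc_list by (simp add: enc_bool_def)
qed

text \<open>Links the abstract and the concrete algorithm: the state \<open>\<sigma>\<close> is
  represented by the list \<open>map (item row \<sigma>)\<close> of the hyperedges in their current
  rotation.\<close>

definition item :: "('a \<Rightarrow> val) \<Rightarrow> 'a set \<times> 'a set \<Rightarrow> 'a \<Rightarrow> val" where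
  "item row = (\<lambda>(S, A) e. Node (row e) (if e \<in> A then Node (Node Leaf Leaf) Leaf else enc_bool (e \<in> S)))"

lemma undecided_item [simp]: "undecided (item row (S, A) e) \<longleftrightarrow> e \<in> A"
  by (simp add: item_def undecided_def enc_bool_def)

lemma left_item [simp]: "left (item row \<sigma> e) = row e"
  by (simp add: item_def split: prod.splits)

context simplicial_elimination
begin

context
  fixes E :: val and row :: "'a \<Rightarrow> val"
  assumes row_conflict: "e \<in> V \<Longrightarrow> f \<in> V \<Longrightarrow> row_conflict E (row e) (row f) \<longleftrightarrow> C e f"
begin

lemma selectable_item:
  assumes "set (e # xs) = V" and "A \<subseteq> V"
  shows "selectable E (enc_list (map (item row (S, A)) (e # xs))) \<longleftrightarrow> e \<in> A \<and> simplicial e A"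
proof -
  have e: "e \<in> V" using assms by auto
  have "selectable E (enc_list (map (item row (S, A)) (e # xs))) \<longleftrightarrow> e \<in> A \<and>
      (\<forall>f\<in>V. \<forall>g\<in>V. f \<in> A \<longrightarrow> g \<in> A \<longrightarrow> row_conflict E (row e) (row f) \<longrightarrow>
        row_conflict E (row e) (row g) \<longrightarrow> row_conflict E (row f) (row g))"
    unfolding selectable_def items_enc_list set_map assms(1) by simp
  also have "\<dots> \<longleftrightarrow> e \<in> A \<and> simplicial e A"
    using assms(2) e by (auto simp: simplicial_def row_conflict subset_iff)
  finally show ?thesis .
qed

lemma step_item:
  assumes V: "set (e # xs) = V" and d: "distinct (e # xs)" and ext: "extendable \<sigma>"
  shows "step E (enc_list (map (item row \<sigma>) (e # xs))) =
    enc_list (map (item row (greedy_step e \<sigma>)) (xs @ [e]))"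
proof -
  obtain S A where \<sigma>: "\<sigma> = (S, A)" by (cases \<sigma>)
  with ext have A: "A \<subseteq> V" and disj: "S \<inter> A = {}" by (auto simp: extendable_def)
  let ?l = "enc_list (map (item row \<sigma>) (e # xs))"
  have sel: "selectable E ?l \<longleftrightarrow> e \<in> A \<and> simplicial e A"
    unfolding \<sigma> by (rule selectable_item[OF V A])
  have l: "left ?l = item row \<sigma> e" "items (right ?l) = map (item row \<sigma>) xs" "?l \<noteq> Leaf" by simp_all
  have "discard E ?l (item row \<sigma> x) = item row (greedy_step e \<sigma>) x" if x: "x \<in> set xs" for x
  proof -
    have "x \<noteq> e" "x \<in> V" "e \<in> V" using x d V by auto
    \<comment> \<open>By \<open>disj\<close>, an element discarded from \<open>A\<close> is not in
      \<open>S\<close>, so the status \<open>Leaf\<close> is its correct output bit.\<close>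
    then show ?thesis
      unfolding discard_def sel l
      by (auto simp: \<sigma> row_conflict greedy_step_def) (use disj in \<open>auto simp: item_def enc_bool_def\<close>)
  qed
  moreover have "(if selectable E ?l then Node (left (item row \<sigma> e)) (Node Leaf Leaf) else item row \<sigma> e)
      = item row (greedy_step e \<sigma>) e"
    unfolding sel by (auto simp: \<sigma> greedy_step_def item_def enc_bool_def)
  ultimately show ?thesis
    unfolding step_def l items_enc_list by (simp add: l(3)[simplified] cong: map_cong)
qed

lemma pass_item:
  assumes V: "set es = V" and d: "distinct es" and ext: "extendable \<sigma>" and E: "length (items E) = length es"
  shows "pass E (enc_list (map (item row \<sigma>) es)) = enc_list (map (item row (fold greedy_step es \<sigma>)) es)"
proof -
  \<comment> \<open>In the induction \<open>vs\<close> collects the items already treated, now at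
    the back. Started with \<open>vs = []\<close>, the original order is back when \<open>us\<close>
    is used up.\<close>
  have "foldl (\<lambda>a _. step E a) (enc_list (map (item row \<sigma>) (us @ vs))) (ys :: val list)
      = enc_list (map (item row (fold greedy_step us \<sigma>)) (vs @ us))"
    if "set (us @ vs) = V" "distinct (us @ vs)" "extendable \<sigma>" "length ys = length us" for us vs \<sigma> ys
    using that
  proof (induction us arbitrary: vs \<sigma> ys)
    case (Cons u us)
    then obtain z zs where ys: "ys = z # zs" by (cases ys) auto
    have "step E (enc_list (map (item row \<sigma>) ((u # us) @ vs)))
        = enc_list (map (item row (greedy_step u \<sigma>)) (us @ (vs @ [u])))"
      using step_item[of u "us @ vs" \<sigma>] Cons.prems by simp
    then show ?case
      using extendable_greedy_step[of \<sigma> u] Cons.IH[of "vs @ [u]" "greedy_step u \<sigma>" zs] Cons.prems ys by auto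
  qed simp
  from this[of es "[]" \<sigma> "items E"] show ?thesis using assms by (simp add: pass_def)
qed

lemma passes_item:
  assumes V: "set es = V" and d: "distinct es" and E: "length (items E) = length es"
  shows "foldl (\<lambda>a _. pass E a) (enc_list (map (item row ({}, V)) es)) (ys :: val list)
    = enc_list (map (item row ((fold greedy_step es ^^ length ys) ({}, V))) es)"
proof (induction ys rule: rev_induct)
  case (snoc y ys)
  show ?case using snoc pass_item[OF V d extendable_greedy[OF extendable_init] E] by simp
qed simp

end

end

lemma algorithm_solves:
  assumes H: "alpha_acyclic H"
  shows "solves_maximum_induced_matching H (algorithm (enc_hypergraph H))"
proof -
  have wf: "wf_hypergraph H" using H by (simp add: alpha_acyclic_def)
  interpret simplicial_elimination "hedges H" "conflict H"
    using wf alpha_acyclic_simplicial[OF H] by unfold_locales (auto simp: wf_hypergraph_def conflict_def)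
  let ?es = "sorted_list_of_set (hedges H)"
  define row where "row = (\<lambda>e. enc_list (map (\<lambda>v. enc_bool (v \<in> ends H e)) (sorted_list_of_set (verts H))))"
  let ?E = "enc_list (map row ?es)"
  have es: "set ?es = hedges H" "distinct ?es" using finite_V by simp_all
  have ends: "ends H e \<subseteq> verts H" if "e \<in> hedges H" for e
    using wf that by (simp add: wf_hypergraph_def)
  \<comment> \<open>Rows record only vertices in \<open>verts H\<close>; by \<open>ends\<close> no
    common vertex is missed.\<close>
  have meets: "row_meets (row e) (row f) \<longleftrightarrow> ends H e \<inter> ends H f \<noteq> {}" if "e \<in> hedges H" for e f
    using ends[OF that] wf unfolding row_def row_meets_enc by (auto simp: wf_hypergraph_def)
  have conf: "row_conflict ?E (row e) (row f) \<longleftrightarrow> conflict H e f" for e f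
    unfolding row_conflict_def conflict_def items_enc_list set_map es(1) by (auto simp: meets)
  obtain S where S: "(fold greedy_step ?es ^^ card (hedges H)) ({}, hedges H) = (S, {})"
    and ind: "independent S" and max: "\<And>I. independent I \<Longrightarrow> card I \<le> card S"
    using greedy_maximum[OF es(1)] by blast
  have "map (\<lambda>r. Node r (Node (Node Leaf Leaf) Leaf)) (items ?E) = map (item row ({}, hedges H)) ?es"
    using es(1) by (simp add: item_def cong: map_cong)
  then have "foldl (\<lambda>a _. pass ?E a) (enc_list (map (\<lambda>r. Node r (Node (Node Leaf Leaf) Leaf)) (items ?E))) (items ?E)
      = enc_list (map (item row (S, {})) ?es)"
    using passes_item[of ?E row ?es "items ?E", OF conf es] S by (simp only: items_enc_list length_map length_sorted_list_of_set)
  moreover have "right (enc_hypergraph H) = ?E" by (simp add: enc_hypergraph_def row_def)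
  \<comment> \<open>With nothing undecided, every status is \<open>enc_bool (e \<in> S)\<close>, so
    the statuses form the characteristic vector of \<open>S\<close>.\<close>
  ultimately have "algorithm (enc_hypergraph H) = enc_hedge_set H S"
    by (simp add: algorithm_def enc_hedge_set_def item_def comp_def)
  moreover have "independent M \<longleftrightarrow> induced_matching H M" for M
    by (simp add: independent_def induced_matching_iff)
  ultimately show ?thesis
    using ind max unfolding solves_maximum_induced_matching_def maximum_induced_matching_def by blast
qed

theorem theorem7:
  "solvable_in_polytime alpha_acyclic enc_hypergraph solves_maximum_induced_matching"
  using polytime_algorithm algorithm_solves by (rule polytime_imp_solvable)

end
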